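(* Let $n>3$, let $F^{n}=(M^{n},L)$ be a Finsler space, and let $F^{*n}=(M^{n},L^{*})$ be a Finsler space obtained from $F^{n}$ by a projective Randers conformal change $L^{*}(x,y)=e^{\sigma(x)}L(x,y)+\beta(x,y)$, where $\sigma$ is a smooth function on $M^{n}$ and $\beta(x,y)=b_{i}(x)y^{i}$ is a 1-form on $M^{n}$. Let $M^{n-1}$ be a hypersurface of $M^{n}$, and let $F^{n-1}=(M^{n-1},\bar L)$ and $F^{*(n-1)}=(M^{n-1},\bar L^{*})$ be the Finslerian hypersurfaces of $F^{n}$ and $F^{*n}$ respectively, with the metrics induced on $M^{n-1}$ by $L$ and $L^{*}$. Then $F^{n-1}$ is totally geodesic in $F^{n}$ if and only if $F^{*(n-1)}$ is totally geodesic in $F^{*n}$.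
   Context: A Finsler space $F^{n}=(M^{n},L)$ is an $n$-dimensional smooth manifold $M^{n}$ with a fundamental function $L(x,y)>0$, smooth for nonzero tangent vectors $y$ and positively homogeneous of degree one in $y$, with fundamental tensor $g_{ij}=\frac12\dot\partial_{i}\dot\partial_{j}L^{2}$, where $\dot\partial_{i}=\partial/\partial y^{i}$. The metrics $L^{2}$ and $L^{*2}$ are assumed positive-definite, i.e. $g_{ij}$ and $g^{*}_{ij}=\frac12\dot\partial_{i}\dot\partial_{j}L^{*2}$ are positive definite; also $L^{*}>0$. A geodesic of $(M^{n},L)$ is a regular curve $x(t)$, with $y^{i}=dx^{i}/dt$, satisfying the Euler-Lagrange equations $\partial L/\partial x^{i}-\frac{d}{dt}(\partial L/\partial y^{i})=0$ (invariant under orientation-preserving reparametrization). The change $L\rightarrow L^{*}$ is called projective if every geodesic of $(M^{n},L)$ is also a geodesic of $(M^{n},L^{*})$ and conversely. A hypersurface $M^{n-1}$ of $M^{n}$ is represented parametrically by $x^{i}=x^{i}(u^{\alpha})$, $\alpha=1,\dots,n-1$, with the matrix $B^{i}_{\alpha}=\partial x^{i}/\partial u^{\alpha}$ of rank $n-1$. The induced metrics are $\bar L(u,v)=L(x(u),y(u,v))$ and $\bar L^{*}(u,v)=L^{*}(x(u),y(u,v))$, where $y^{i}=B^{i}_{\alpha}(u)v^{\alpha}$. The hypersurface $F^{n-1}=(M^{n-1},\bar L)$ of $F^{n}$ is called totally geodesic if each geodesic of $F^{n-1}$ with respect to the induced metric $\bar L$ is also a geodesic of $F^{n}$; the same definition,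 with $\bar L^{*}$ and $L^{*}$, applies to $F^{*(n-1)}$ in $F^{*n}$. *)

theory Defs
  imports "HOL-Analysis.Analysis"
begin

section \<open>Smooth maps between Euclidean spaces\<close>

text \<open>
  \<open>C_k k S f\<close> is only meant for open \<open>S\<close>: derivatives are taken at the points of \<open>S\<close> in
  the ambient space. Since the domain is finite-dimensional, controlling all directional
  derivatives of \<open>f\<close> is the same as controlling its Frechet derivative.
\<close>

primrec C_k :: "nat \<Rightarrow> 'a::euclidean_space set \<Rightarrow> ('a \<Rightarrow> 'b::real_normed_vector) \<Rightarrow> bool" where
  "C_k 0 S f \<longleftrightarrow> continuous_on S f"
| "C_k (Suc k) S f \<longleftrightarrow> (\<forall>x\<in>S. f differentiable (at x)) \<and>
     (\<forall>v. C_k k S (\<lambda>x. frechet_derivative f (at x) v))"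

definition smooth_on :: "'a::euclidean_space set \<Rightarrow> ('a \<Rightarrow> 'b::real_normed_vector) \<Rightarrow> bool" where
  "smooth_on S f \<longleftrightarrow> (\<forall>k. C_k k S f)"

definition partial :: "'n \<Rightarrow> (real^'n \<Rightarrow> real) \<Rightarrow> real^'n \<Rightarrow> real" where
  "partial i F x = frechet_derivative F (at x) (axis i 1)"

section \<open>Smooth manifolds\<close>

text \<open>
  A manifold is given by an atlas; its underlying set is the union of the chart domains, an
  open subset of a Hausdorff second countable type. A chart is a pair of its domain and its
  coordinate map.
\<close>

type_synonym ('p, 'n) chart = "'p set \<times> ('p \<Rightarrow> real^'n)"

abbreviation dom_of :: "('p, 'n) chart \<Rightarrow> 'p set" where "dom_of c \<equiv> fst c"
abbreviation coord :: "('p, 'n) chart \<Rightarrow> 'p \<Rightarrow> real^'n" where "coord c \<equiv> snd c"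
abbreviation cod_of :: "('p, 'n) chart \<Rightarrow> (real^'n) set" where "cod_of c \<equiv> coord c ` dom_of c"

definition inv_coord :: "('p, 'n) chart \<Rightarrow> real^'n \<Rightarrow> 'p" where
  "inv_coord c = inv_into (dom_of c) (coord c)"

definition points :: "('p, 'n) chart set \<Rightarrow> 'p set" where
  "points A = (\<Union>c\<in>A. dom_of c)"

definition is_chart :: "('p::topological_space, 'n::finite) chart \<Rightarrow> bool" where
  "is_chart c \<longleftrightarrow> open (dom_of c) \<and> open (cod_of c) \<and>
     homeomorphism (dom_of c) (cod_of c) (coord c) (inv_coord c)"

definition smooth_manifold ::
    "('p::{t2_space, second_countable_topology}, 'n::finite) chart set \<Rightarrow> bool" where
  "smooth_manifold A \<longleftrightarrow> (\<forall>c\<in>A. is_chart c) \<and>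
     (\<forall>c\<in>A. \<forall>d\<in>A. smooth_on (coord c ` (dom_of c \<inter> dom_of d)) (coord d \<circ> inv_coord c))"

definition smooth_fun ::
    "('p::topological_space, 'n::finite) chart set \<Rightarrow> ('p \<Rightarrow> real) \<Rightarrow> bool" where
  "smooth_fun A g \<longleftrightarrow> (\<forall>c\<in>A. smooth_on (cod_of c) (g \<circ> inv_coord c))"

definition smooth_map ::
    "('q::topological_space, 'm::finite) chart set \<Rightarrow>
     ('p::topological_space, 'n::finite) chart set \<Rightarrow> ('q \<Rightarrow> 'p) \<Rightarrow> bool" where
  "smooth_map N A f \<longleftrightarrow> f ` points N \<subseteq> points A \<and> continuous_on (points N) f \<and>
     (\<forall>c\<in>N. \<forall>d\<in>A. smooth_on (coord c ` (dom_of c \<inter> f -` dom_of d)) (coord d \<circ> f \<circ> inv_coord c))"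

section \<open>Tangent vectors and forms\<close>

text \<open>
  Tangent vectors at \<open>p\<close> are derivations on the smooth functions (with value \<open>0\<close> on all other
  functions, so that a vector is determined by its action on smooth functions).
  \<open>chart_vec A c p y\<close> is the vector at \<open>p\<close> with components \<open>y\<close> in the chart \<open>c\<close>, that is,
  the sum of the \<open>y $ i\<close> times the coordinate fields.
\<close>

type_synonym 'p tvec = "('p \<Rightarrow> real) \<Rightarrow> real"

definition chart_vec ::
    "('p::topological_space, 'n::finite) chart set \<Rightarrow> ('p, 'n) chart \<Rightarrow> 'p \<Rightarrow> real^'n \<Rightarrow> 'p tvec" where
  "chart_vec A c p y =
     (\<lambda>g. if smooth_fun A g then frechet_derivative (g \<circ> inv_coord c) (at (coord c p)) y else 0)"

definition tangent_space ::
    "('p::topological_space, 'n::finite) chart set \<Rightarrow> 'p \<Rightarrow> 'p tvec set" where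
  "tangent_space A p = {chart_vec A c p y | c y. c \<in> A \<and> p \<in> dom_of c}"

definition pushforward ::
    "('p::topological_space, 'n::finite) chart set \<Rightarrow> ('q \<Rightarrow> 'p) \<Rightarrow> 'q tvec \<Rightarrow> 'p tvec" where
  "pushforward A f w = (\<lambda>g. if smooth_fun A g then w (g \<circ> f) else 0)"

text \<open>
  A function on the tangent bundle takes a point and a tangent vector there; \<open>local_rep\<close> is its
  expression in the coordinates \<open>(x, y)\<close> of a chart.
\<close>

type_synonym 'p tb_fun = "'p \<Rightarrow> 'p tvec \<Rightarrow> real"

definition local_rep ::
    "('p::topological_space, 'n::finite) chart set \<Rightarrow> 'p tb_fun \<Rightarrow> ('p, 'n) chart \<Rightarrow>
     real^'n \<Rightarrow> real^'n \<Rightarrow> real" where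
  "local_rep A L c x y = L (inv_coord c x) (chart_vec A c (inv_coord c x) y)"

definition one_form ::
    "('p::topological_space, 'n::finite) chart set \<Rightarrow> 'p tb_fun \<Rightarrow> bool" where
  "one_form A \<beta> \<longleftrightarrow> (\<forall>c\<in>A. \<exists>b :: real^'n \<Rightarrow> real^'n. smooth_on (cod_of c) b \<and>
     (\<forall>x\<in>cod_of c. \<forall>y. local_rep A \<beta> c x y = (\<Sum>i\<in>UNIV. b x $ i * y $ i)))"

section \<open>Finsler spaces and geodesics\<close>

definition fundamental_tensor ::
    "(real^'n \<Rightarrow> real^'n \<Rightarrow> real) \<Rightarrow> real^'n \<Rightarrow> real^'n \<Rightarrow> 'n \<Rightarrow> 'n \<Rightarrow> real" where
  "fundamental_tensor F x y i j = 1/2 * partial i (\<lambda>z. partial j (\<lambda>w. (F x w)\<^sup>2) z) y"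

definition finsler ::
    "('p::topological_space, 'n::finite) chart set \<Rightarrow> 'p tb_fun \<Rightarrow> bool" where
  "finsler A L \<longleftrightarrow> (\<forall>c\<in>A.
     smooth_on (cod_of c \<times> {y. y \<noteq> 0}) (\<lambda>(x, y). local_rep A L c x y) \<and>
     (\<forall>x\<in>cod_of c.
        (\<forall>y. \<forall>k>0. local_rep A L c x (k *\<^sub>R y) = k * local_rep A L c x y) \<and>
        (\<forall>y. y \<noteq> 0 \<longrightarrow> local_rep A L c x y > 0 \<and>
           (\<forall>\<xi>. \<xi> \<noteq> 0 \<longrightarrow> (\<Sum>i\<in>UNIV. \<Sum>j\<in>UNIV.
              fundamental_tensor (local_rep A L c) x y i j * \<xi> $ i * \<xi> $ j) > 0))))"

text \<open>
  Curves are parametrized over nonempty open (possibly unbounded) intervals. Regular means twice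
  continuously differentiable, which is what the Euler-Lagrange equations need, with nowhere
  vanishing velocity. As these equations are invariant under reparametrization, no particular
  parametrization is singled out.
\<close>

definition regular_curve ::
    "('p::topological_space, 'n::finite) chart set \<Rightarrow> real set \<Rightarrow> (real \<Rightarrow> 'p) \<Rightarrow> bool" where
  "regular_curve A I \<gamma> \<longleftrightarrow> I \<noteq> {} \<and> open I \<and> is_interval I \<and>
     \<gamma> ` I \<subseteq> points A \<and> continuous_on I \<gamma> \<and>
     (\<forall>c\<in>A. C_k 2 {t\<in>I. \<gamma> t \<in> dom_of c} (coord c \<circ> \<gamma>) \<and>
        (\<forall>t\<in>I. \<gamma> t \<in> dom_of c \<longrightarrow> vector_derivative (coord c \<circ> \<gamma>) (at t) \<noteq> 0))"

definition euler_lagrange_at ::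
    "(real^'n::finite \<Rightarrow> real^'n \<Rightarrow> real) \<Rightarrow> (real \<Rightarrow> real^'n) \<Rightarrow> real \<Rightarrow> bool" where
  "euler_lagrange_at F x t \<longleftrightarrow>
     (let y = (\<lambda>s. vector_derivative x (at s)) in
      \<forall>i. ((\<lambda>s. partial i (F (x s)) (y s)) has_real_derivative
             partial i (\<lambda>z. F z (y t)) (x t)) (at t))"

definition geodesic ::
    "('p::topological_space, 'n::finite) chart set \<Rightarrow> 'p tb_fun \<Rightarrow> real set \<Rightarrow> (real \<Rightarrow> 'p) \<Rightarrow> bool" where
  "geodesic A L I \<gamma> \<longleftrightarrow> regular_curve A I \<gamma> \<and>
     (\<forall>c\<in>A. \<forall>t\<in>I. \<gamma> t \<in> dom_of c \<longrightarrow> euler_lagrange_at (local_rep A L c) (coord c \<circ> \<gamma>) t)"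

definition projectively_related ::
    "('p::topological_space, 'n::finite) chart set \<Rightarrow> 'p tb_fun \<Rightarrow> 'p tb_fun \<Rightarrow> bool" where
  "projectively_related A L L' \<longleftrightarrow> (\<forall>I \<gamma>. geodesic A L I \<gamma> \<longleftrightarrow> geodesic A L' I \<gamma>)"

definition randers_conformal_change ::
    "('p::topological_space, 'n::finite) chart set \<Rightarrow> ('p \<Rightarrow> real) \<Rightarrow> 'p tb_fun \<Rightarrow>
     'p tb_fun \<Rightarrow> 'p tb_fun \<Rightarrow> bool" where
  "randers_conformal_change A \<sigma> \<beta> L L' \<longleftrightarrow> smooth_fun A \<sigma> \<and> one_form A \<beta> \<and>
     (\<forall>p\<in>points A. \<forall>v\<in>tangent_space A p. L' p v = exp (\<sigma> p) * L p v + \<beta> p v)"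

section \<open>Hypersurfaces\<close>

text \<open>
  A hypersurface is an immersed manifold \<open>N\<close> of codimension one; \<open>f\<close> is the parametrization
  \<open>u \<mapsto> x(u)\<close>.
\<close>

definition hypersurface ::
    "('q::{t2_space, second_countable_topology}, 'm::finite) chart set \<Rightarrow>
     ('p::{t2_space, second_countable_topology}, 'n::finite) chart set \<Rightarrow> ('q \<Rightarrow> 'p) \<Rightarrow> bool" where
  "hypersurface N A f \<longleftrightarrow> CARD('m) + 1 = CARD('n) \<and> smooth_manifold N \<and> smooth_map N A f \<and>
     (\<forall>c\<in>N. \<forall>d\<in>A. \<forall>q\<in>dom_of c. f q \<in> dom_of d \<longrightarrow>
        rank (jacobian (coord d \<circ> f \<circ> inv_coord c) (at (coord c q))) = CARD('m))"

definition induced ::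
    "('p::topological_space, 'n::finite) chart set \<Rightarrow> ('q \<Rightarrow> 'p) \<Rightarrow> 'p tb_fun \<Rightarrow> 'q tb_fun" where
  "induced A f L = (\<lambda>q w. L (f q) (pushforward A f w))"

definition totally_geodesic ::
    "('q::topological_space, 'm::finite) chart set \<Rightarrow>
     ('p::topological_space, 'n::finite) chart set \<Rightarrow> ('q \<Rightarrow> 'p) \<Rightarrow> 'p tb_fun \<Rightarrow> bool" where
  "totally_geodesic N A f L \<longleftrightarrow>
     (\<forall>I \<gamma>. geodesic N (induced A f L) I \<gamma> \<longrightarrow> geodesic A L I (f \<circ> \<gamma>))"

section \<open>Tangent vectors and induced metrics in coordinates\<close>

lemma C_k_cong:
  assumes "open S" "\<And>x. x \<in> S \<Longrightarrow> f x = g x" "C_k k S f"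
  shows "C_k k S g"
  using assms
proof (induction k arbitrary: f g)
  case 0
  then show ?case by (auto cong: continuous_on_cong)
next
  case (Suc k)
  have df: "(f has_derivative frechet_derivative f (at x)) (at x)" if "x \<in> S" for x
    using Suc.prems(3) that by (simp add: frechet_derivative_works)
  have der: "(g has_derivative frechet_derivative f (at x)) (at x)" if "x \<in> S" for x
    using has_derivative_transform_within_open[OF df[OF that] Suc.prems(1) that] Suc.prems(2) by blast
  have fr: "frechet_derivative f (at x) = frechet_derivative g (at x)" if "x \<in> S" for x
    by (rule frechet_derivative_at[OF der[OF that]])
  have "C_k k S (\<lambda>x. frechet_derivative g (at x) v)" for v
    by (rule Suc.IH[OF Suc.prems(1), of "\<lambda>x. frechet_derivative f (at x) v"])
       (use fr Suc.prems in auto)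
  then show ?case using der by (auto simp: differentiable_def)
qed

lemma C_k_SucD:
  "C_k (Suc k) S f \<Longrightarrow> x \<in> S \<Longrightarrow> (f has_derivative frechet_derivative f (at x)) (at x)"
  by (simp add: frechet_derivative_works)

lemma C_k_SucI:
  assumes "open S" "\<And>x. x \<in> S \<Longrightarrow> (f has_derivative D x) (at x)" "\<And>v. C_k k S (\<lambda>x. D x v)"
  shows "C_k (Suc k) S f"
proof -
  have "C_k k S (\<lambda>x. frechet_derivative f (at x) v)" for v
    by (rule C_k_cong[OF assms(1) _ assms(3)]) (simp add: frechet_derivative_at[OF assms(2)])
  then show ?thesis using assms(2) by (auto simp: differentiable_def)
qed

lemma C_k_Suc_le: "C_k (Suc k) S f \<Longrightarrow> C_k k S f"
proof (induction k arbitrary: f)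
  case 0
  then show ?case
    by (auto intro!: continuous_at_imp_continuous_on differentiable_imp_continuous_within)
next
  case (Suc k)
  have "C_k k S (\<lambda>x. frechet_derivative f (at x) v)" for v
    by (rule Suc.IH) (use Suc.prems in simp)
  then show ?case using Suc.prems by simp
qed

lemma C_k_const: "C_k k S (\<lambda>x. c)"
  by (induction k arbitrary: c) auto

lemma C_k_bounded_linear:
  assumes "bounded_linear h" "open S" "C_k k S f"
  shows "C_k k S (\<lambda>x. h (f x))"
  using assms(3)
proof (induction k arbitrary: f)
  case 0
  then show ?case using assms(1) by (simp add: bounded_linear.continuous_on)
next
  case (Suc k)
  show ?case
    by (rule C_k_SucI[OF assms(2) bounded_linear.has_derivative[OF assms(1) C_k_SucD[OF Suc.prems]]])
       (use Suc in auto)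
qed

lemma C_k_add:
  assumes "open S" "C_k k S f" "C_k k S g"
  shows "C_k k S (\<lambda>x. f x + g x)"
  using assms(2,3)
proof (induction k arbitrary: f g)
  case 0
  then show ?case by (simp add: continuous_on_add)
next
  case (Suc k)
  show ?case
    by (rule C_k_SucI[OF assms(1) has_derivative_add[OF Suc.prems[THEN C_k_SucD]]])
       (use Suc in auto)
qed

lemma C_k_sum:
  assumes "open S" "finite B" "\<And>b. b \<in> B \<Longrightarrow> C_k k S (f b)"
  shows "C_k k S (\<lambda>x. \<Sum>b\<in>B. f b x)"
  using assms(2,3) by (induction B) (auto intro!: C_k_const C_k_add assms(1))

lemma C_k_scaleR:
  assumes "open S" "C_k k S f" "C_k k S g"
  shows "C_k k S (\<lambda>x. f x *\<^sub>R g x)"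
  using assms(2,3)
proof (induction k arbitrary: f g)
  case 0
  then show ?case by (simp add: continuous_on_scaleR)
next
  case (Suc k)
  show ?case
    by (rule C_k_SucI[OF assms(1) has_derivative_scaleR[OF Suc.prems[THEN C_k_SucD]]])
       (use Suc C_k_Suc_le[OF Suc.prems(1)] C_k_Suc_le[OF Suc.prems(2)] in \<open>auto intro!: C_k_add assms(1)\<close>)
qed

lemma C_k_compose:
  fixes f :: "'a::euclidean_space \<Rightarrow> 'b::euclidean_space" and g :: "'b \<Rightarrow> 'c::real_normed_vector"
  assumes "open S" "f ` S \<subseteq> T" "C_k k S f" "C_k k T g"
  shows "C_k k S (g \<circ> f)"
  using assms(3,4)
proof (induction k arbitrary: g)
  case 0
  then show ?case using assms(2) unfolding C_k.simps by (metis continuous_on_compose continuous_on_subset)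
next
  case (Suc k)
  let ?D = "\<lambda>x. frechet_derivative f (at x)" and ?E = "\<lambda>x. frechet_derivative g (at (f x))"
  have Ed: "(g has_derivative ?E x) (at (f x))" if "x \<in> S" for x
    by (rule C_k_SucD[OF Suc.prems(2)]) (use assms(2) that in auto)
  have eq: "(?E x \<circ> ?D x) v = (\<Sum>b\<in>Basis. (?D x v \<bullet> b) *\<^sub>R ?E x b)" if "x \<in> S" for x v
  proof -
    interpret linear "?E x" using has_derivative_linear[OF Ed[OF that]] .
    have "?E x (\<Sum>b\<in>Basis. (?D x v \<bullet> b) *\<^sub>R b) = (\<Sum>b\<in>Basis. (?D x v \<bullet> b) *\<^sub>R ?E x b)"
      by (simp add: sum scaleR)
    then show ?thesis by (simp add: euclidean_representation)
  qed
  have C: "C_k k S (\<lambda>x. \<Sum>b\<in>Basis. (?D x v \<bullet> b) *\<^sub>R ?E x b)" for v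
  proof (intro C_k_sum C_k_scaleR assms(1) finite_Basis)
    fix b :: 'b
    have "C_k k S (\<lambda>x. ?D x v)" using Suc.prems(1) by simp
    then show "C_k k S (\<lambda>x. ?D x v \<bullet> b)"
      by (rule C_k_bounded_linear[OF bounded_linear_inner_left assms(1)])
    have "C_k k S ((\<lambda>z. frechet_derivative g (at z) b) \<circ> f)"
      by (rule Suc.IH[OF C_k_Suc_le[OF Suc.prems(1)]]) (use Suc.prems(2) in simp)
    then show "C_k k S (\<lambda>x. ?E x b)" by (simp add: o_def)
  qed
  have der: "(g \<circ> f has_derivative ?E x \<circ> ?D x) (at x)" if "x \<in> S" for x
    by (rule diff_chain_at[OF C_k_SucD[OF Suc.prems(1) that] Ed[OF that]])
  show ?case
    by (rule C_k_SucI[OF assms(1) der]) (auto intro: C_k_cong[OF assms(1) _ C] simp: eq[symmetric])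
qed

lemma C_k_local:
  assumes "\<And>x. x \<in> S \<Longrightarrow> \<exists>U. open U \<and> x \<in> U \<and> C_k k U f"
  shows "C_k k S f"
  using assms
proof (induction k arbitrary: f)
  case 0
  show ?case
    unfolding C_k.simps
  proof (rule continuous_at_imp_continuous_on, rule ballI)
    fix x assume "x \<in> S"
    then obtain U where "open U" "x \<in> U" "C_k 0 U f" using 0 by blast
    then show "isCont f x" by (simp add: continuous_on_eq_continuous_at)
  qed
next
  case (Suc k)
  have "f differentiable (at x)" if "x \<in> S" for x using Suc.prems[OF that] by auto
  moreover have "C_k k S (\<lambda>x. frechet_derivative f (at x) v)" for v
  proof (rule Suc.IH)
    fix x assume "x \<in> S"
    then obtain U where "open U" "x \<in> U" "C_k (Suc k) U f" using Suc.prems by blast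
    then show "\<exists>U. open U \<and> x \<in> U \<and> C_k k U (\<lambda>x. frechet_derivative f (at x) v)" by auto
  qed
  ultimately show ?case by simp
qed

lemma smooth_on_differentiable: "smooth_on S f \<Longrightarrow> x \<in> S \<Longrightarrow> f differentiable (at x)"
  unfolding smooth_on_def by (metis C_k.simps(2))

lemma chart_facts:
  assumes "is_chart c"
  shows "p \<in> dom_of c \<Longrightarrow> inv_coord c (coord c p) = p"
    and "x \<in> cod_of c \<Longrightarrow> coord c (inv_coord c x) = x"
    and "x \<in> cod_of c \<Longrightarrow> inv_coord c x \<in> dom_of c"
    and "open U \<Longrightarrow> open (coord c ` (dom_of c \<inter> U))"
    and "open (cod_of c)" and "open (dom_of c)"
    and "continuous_on (cod_of c) (inv_coord c)"
proof -
  have h: "homeomorphism (dom_of c) (cod_of c) (coord c) (inv_coord c)"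
    and o: "open (cod_of c)" "open (dom_of c)" using assms by (auto simp: is_chart_def)
  show "p \<in> dom_of c \<Longrightarrow> inv_coord c (coord c p) = p"
    "x \<in> cod_of c \<Longrightarrow> coord c (inv_coord c x) = x"
    "x \<in> cod_of c \<Longrightarrow> inv_coord c x \<in> dom_of c"
    "continuous_on (cod_of c) (inv_coord c)" "open (cod_of c)" "open (dom_of c)"
    using h o by (auto simp: homeomorphism_def)
  show "open (coord c ` (dom_of c \<inter> U))" if "open U"
    using homeomorphism_imp_open_map[OF h openin_open_Int[OF that]] o(1)
    by (rule openin_open_trans)
qed

lemma smooth_map_open_preimage:
  assumes "smooth_manifold N" "smooth_map N A f" "c \<in> N" "open V"
  shows "open (coord c ` (dom_of c \<inter> f -` V))"
proof -
  have c: "is_chart c" using assms by (auto simp: smooth_manifold_def)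
  have "continuous_on (dom_of c) f"
    using assms(2,3) by (auto simp: smooth_map_def points_def intro: continuous_on_subset)
  then have "open (dom_of c \<inter> f -` V)"
    using chart_facts(6)[OF c] assms(4) continuous_on_open_vimage by (metis inf_commute)
  from chart_facts(4)[OF c this] show ?thesis by (simp add: Int_absorb1)
qed

lemma smooth_fun_compose:
  assumes N: "smooth_manifold N" and A: "smooth_manifold A"
    and f: "smooth_map N A f" and g: "smooth_fun A g"
  shows "smooth_fun N (g \<circ> f)"
  unfolding smooth_fun_def smooth_on_def
proof (intro ballI allI)
  fix c k assume c: "c \<in> N"
  have cc: "is_chart c" using N c by (auto simp: smooth_manifold_def)
  show "C_k k (cod_of c) (g \<circ> f \<circ> inv_coord c)"
  proof (rule C_k_local)
    fix x assume "x \<in> cod_of c"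
    then obtain q where q: "q \<in> dom_of c" "x = coord c q" by auto
    then have "f q \<in> points A" using f c by (fastforce simp: smooth_map_def points_def)
    then obtain d where d: "d \<in> A" "f q \<in> dom_of d" by (auto simp: points_def)
    have dd: "is_chart d" using A d by (auto simp: smooth_manifold_def)
    let ?U = "coord c ` (dom_of c \<inter> f -` dom_of d)"
    have oU: "open ?U" by (rule smooth_map_open_preimage[OF N f c chart_facts(6)[OF dd]])
    have "C_k k ?U ((g \<circ> inv_coord d) \<circ> (coord d \<circ> f \<circ> inv_coord c))"
      by (rule C_k_compose[OF oU, where T = "cod_of d"])
         (use f g c d chart_facts(1)[OF cc] in \<open>auto simp: smooth_map_def smooth_fun_def smooth_on_def\<close>)
    then have "C_k k ?U (g \<circ> f \<circ> inv_coord c)"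
      by (rule C_k_cong[OF oU, rotated]) (auto simp: chart_facts(1)[OF cc] chart_facts(1)[OF dd])
    then show "\<exists>U. open U \<and> x \<in> U \<and> C_k k U (g \<circ> f \<circ> inv_coord c)" using oU q d by blast
  qed
qed

text \<open>In coordinates the pushforward is \<open>v \<mapsto> B v\<close>, where \<open>B\<close> is the derivative of \<open>u \<mapsto> x(u)\<close>.\<close>

lemma pushforward_chart_vec:
  fixes A :: "('p::{t2_space,second_countable_topology}, 'n::finite) chart set"
  assumes N: "smooth_manifold N" and A: "smooth_manifold A" and f: "smooth_map N A f"
    and c: "c \<in> N" "q \<in> dom_of c" and d: "d \<in> A" "f q \<in> dom_of d"
  shows "pushforward A f (chart_vec N c q v) =
    chart_vec A d (f q) (frechet_derivative (coord d \<circ> f \<circ> inv_coord c) (at (coord c q)) v)"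
proof
  fix g :: "'p \<Rightarrow> real"
  let ?F = "coord d \<circ> f \<circ> inv_coord c" and ?G = "g \<circ> inv_coord d" and ?x = "coord c q"
  show "pushforward A f (chart_vec N c q v) g =
    chart_vec A d (f q) (frechet_derivative ?F (at ?x) v) g"
  proof (cases "smooth_fun A g")
    case True
    have cc: "is_chart c" and dd: "is_chart d" using N A c d by (auto simp: smooth_manifold_def)
    let ?U = "coord c ` (dom_of c \<inter> f -` dom_of d)"
    have oU: "open ?U" by (rule smooth_map_open_preimage[OF N f c(1) chart_facts(6)[OF dd]])
    have xU: "?x \<in> ?U" using c d by auto
    have Fx: "?F ?x = coord d (f q)" using chart_facts(1)[OF cc c(2)] by simp
    have "?F differentiable (at ?x)"
      by (rule smooth_on_differentiable[OF _ xU]) (use f c(1) d(1) in \<open>auto simp: smooth_map_def\<close>)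
    then have 1: "(?F has_derivative frechet_derivative ?F (at ?x)) (at ?x)"
      by (simp only: frechet_derivative_works)
    have "?G differentiable (at (?F ?x))"
      unfolding Fx by (rule smooth_on_differentiable[of "cod_of d"]) (use True d in \<open>auto simp: smooth_fun_def\<close>)
    then have 2: "(?G has_derivative frechet_derivative ?G (at (?F ?x))) (at (?F ?x))"
      by (simp only: frechet_derivative_works)
    have "(g \<circ> f \<circ> inv_coord c has_derivative
        frechet_derivative ?G (at (?F ?x)) \<circ> frechet_derivative ?F (at ?x)) (at ?x)"
      by (rule has_derivative_transform_within_open[OF diff_chain_at[OF 1 2] oU xU])
         (auto simp: chart_facts(1)[OF cc] chart_facts(1)[OF dd])
    from frechet_derivative_at[OF this, symmetric] True smooth_fun_compose[OF N A f True] show ?thesis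
      by (simp only: pushforward_def chart_vec_def if_True o_apply chart_facts(1)[OF cc c(2)])
  qed (simp add: pushforward_def chart_vec_def)
qed

lemma smooth_map_id: "smooth_manifold A \<Longrightarrow> smooth_map A A id"
  by (auto simp: smooth_map_def smooth_manifold_def comp_def)

text \<open>Components of a tangent vector transform with the derivative of the chart change.\<close>

lemma chart_vec_transform:
  assumes A: "smooth_manifold A" and c: "c \<in> A" "p \<in> dom_of c" and d: "d \<in> A" "p \<in> dom_of d"
  shows "chart_vec A c p y =
    chart_vec A d p (frechet_derivative (coord d \<circ> inv_coord c) (at (coord c p)) y)"
proof -
  have "pushforward A id (chart_vec A c p y) = chart_vec A c p y"
    by (auto simp: pushforward_def chart_vec_def)
  with pushforward_chart_vec[OF A A smooth_map_id[OF A] c d(1), of y] d(2) show ?thesis by simp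
qed

text \<open>The induced metric is \<open>L(x(u), B v)\<close> in any coordinates.\<close>

lemma local_rep_induced:
  fixes A :: "('p::{t2_space,second_countable_topology}, 'n::finite) chart set"
  assumes N: "smooth_manifold N" and A: "smooth_manifold A" and f: "smooth_map N A f"
    and c: "c \<in> N" "u \<in> cod_of c" and d: "d \<in> A" "f (inv_coord c u) \<in> dom_of d"
  shows "local_rep N (induced A f L) c u v =
    local_rep A L d ((coord d \<circ> f \<circ> inv_coord c) u)
      (frechet_derivative (coord d \<circ> f \<circ> inv_coord c) (at u) v)"
proof -
  have cc: "is_chart c" and dd: "is_chart d" using N A c d by (auto simp: smooth_manifold_def)
  show ?thesis
    using pushforward_chart_vec[OF N A f c(1) chart_facts(3)[OF cc c(2)] d] chart_facts(1)[OF dd d(2)]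
      chart_facts(2)[OF cc c(2)]
    by (simp add: local_rep_def induced_def)
qed

end

theory Submission
  imports Defs
begin

text \<open>
  At a point \<open>x\<close> with velocity \<open>y \<noteq> 0\<close> the Euler-Lagrange equations of a Finsler function \<open>F\<close>
  are a linear system for the acceleration, whose matrix is the Hessian of \<open>F\<close> in the velocity
  variables. Homogeneity puts \<open>y\<close> into the kernel of that Hessian, and positive definiteness of the
  fundamental tensor leaves nothing else there. Hence the admissible accelerations at \<open>(x, y)\<close> form
  a single line parallel to \<open>y\<close>: \<open>local_finsler.euler_lagrange_acc_unique\<close> and
  \<open>local_finsler.euler_lagrange_acc_shift\<close>. Geodesics with the same initial direction thus
  have the same acceleration up to reparametrization.

  Let the hypersurface be totally geodesic for \<open>L\<close>, and let \<open>\<gamma>\<close> be a geodesic of the metric induced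
  by \<open>L\<^sup>*\<close>. Fix a time \<open>t\<close>. There is a geodesic \<open>\<delta>\<close> of the metric induced by \<open>L\<close> that starts at
  \<open>\<gamma>(t)\<close> with the velocity of \<open>\<gamma>\<close> (\<open>local_finsler.geodesic_exists\<close>). Total geodesy makes it a
  geodesic of \<open>L\<close> in the ambient manifold, and projectivity makes it one of \<open>L\<^sup>*\<close>.
  Since the Euler-Lagrange equations pull back along immersions
  (\<open>immersion.euler_lagrange_acc_pullback\<close>), \<open>\<delta>\<close> is then also a geodesic of the metric induced by
  \<open>L\<^sup>*\<close>. So \<open>\<gamma>\<close> and \<open>\<delta>\<close> satisfy the same equations with the same initial velocity, and
  their accelerations differ by a multiple of that velocity. The same is true of their images in the
  ambient manifold, so there the equations of \<open>L\<^sup>*\<close> carry over from \<open>\<delta>\<close> to \<open>\<gamma>\<close>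
  (\<open>immersion.euler_lagrange_curve_pushforward\<close>). Exchanging the roles of \<open>L\<close> and \<open>L\<^sup>*\<close> gives the
  converse.

  Every step except the existence of \<open>\<delta>\<close> takes place at a single point of the tangent bundle.
  For \<open>\<delta>\<close> the equations of \<open>F\<close> are replaced by those of \<open>F\<^sup>2\<close>, whose Hessian is invertible.
\<close>

section \<open>First and second derivatives of smooth maps\<close>

abbreviation D1 :: "('a::euclidean_space \<Rightarrow> 'b::real_normed_vector) \<Rightarrow> 'a \<Rightarrow> 'a \<Rightarrow> 'b" where
  "D1 f x v \<equiv> frechet_derivative f (at x) v"

text \<open>In \<open>D2 f x u v\<close> the inner derivative is taken in the direction \<open>v\<close>, the outer one along \<open>u\<close>.\<close>

abbreviation D2 :: "('a::euclidean_space \<Rightarrow> 'b::real_normed_vector) \<Rightarrow> 'a \<Rightarrow> 'a \<Rightarrow> 'a \<Rightarrow> 'b" where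
  "D2 f x u v \<equiv> D1 (\<lambda>z. D1 f z v) x u"

lemma smooth_on_C_k: "smooth_on S f \<Longrightarrow> C_k k S f"
  by (simp add: smooth_on_def)

lemma smooth_on_D1: "smooth_on S f \<Longrightarrow> smooth_on S (\<lambda>x. D1 f x v)"
  unfolding smooth_on_def by (metis C_k.simps(2))

lemma smooth_on_has_derivative:
  "smooth_on S f \<Longrightarrow> x \<in> S \<Longrightarrow> (f has_derivative (\<lambda>v. D1 f x v)) (at x)"
  using smooth_on_differentiable frechet_derivative_works by (metis eta_contract_eq)

lemma C_k_mono: "C_k k T f \<Longrightarrow> S \<subseteq> T \<Longrightarrow> C_k k S f"
  by (induction k arbitrary: f) (auto intro: continuous_on_subset)

lemma smooth_on_subset: "smooth_on T f \<Longrightarrow> S \<subseteq> T \<Longrightarrow> smooth_on S f"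
  by (auto simp: smooth_on_def intro: C_k_mono)

lemma smooth_on_continuous_on: "smooth_on S f \<Longrightarrow> continuous_on S f"
  using smooth_on_C_k[of S f 0] by simp

lemma D1_eqI: "(f has_derivative f') (at x) \<Longrightarrow> D1 f x v = f' v"
  using frechet_derivative_at by metis

lemma D1_basis:
  assumes "smooth_on S f" "x \<in> S"
  shows "D1 f x v = (\<Sum>b\<in>Basis. (v \<bullet> b) *\<^sub>R D1 f x b)"
proof -
  interpret linear "D1 f x" using smooth_on_has_derivative[OF assms] by (rule has_derivative_linear)
  have "D1 f x (\<Sum>b\<in>Basis. (v \<bullet> b) *\<^sub>R b) = (\<Sum>b\<in>Basis. (v \<bullet> b) *\<^sub>R D1 f x b)"
    by (simp add: sum scaleR)
  then show ?thesis by (simp add: euclidean_representation)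
qed

text \<open>A direction that varies with the point is expanded in the basis, which reduces its
  differentiation to that of derivatives in constant directions.\<close>

lemma D1_moving_basis:
  assumes f: "smooth_on S f" "open S" and h: "(h has_derivative h') (at c)" "h c \<in> S"
    and g: "(g has_derivative g') (at c)"
  shows "((\<lambda>c. D1 f (h c) (g c)) has_derivative
    (\<lambda>p. \<Sum>b\<in>Basis. (g c \<bullet> b) *\<^sub>R D2 f (h c) (h' p) b + (g' p \<bullet> b) *\<^sub>R D1 f (h c) b)) (at c)"
proof (rule has_derivative_transform_eventually)
  have D: "((\<lambda>c. D1 f (h c) b) has_derivative (\<lambda>p. D2 f (h c) (h' p) b)) (at c)" for b
    using diff_chain_at[OF h(1) smooth_on_has_derivative[OF smooth_on_D1[OF f(1)] h(2)]]
    by (simp add: o_def)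
  show "((\<lambda>c. \<Sum>b\<in>Basis. (g c \<bullet> b) *\<^sub>R D1 f (h c) b) has_derivative
    (\<lambda>p. \<Sum>b\<in>Basis. (g c \<bullet> b) *\<^sub>R D2 f (h c) (h' p) b + (g' p \<bullet> b) *\<^sub>R D1 f (h c) b)) (at c)"
    by (intro has_derivative_sum has_derivative_scaleR D has_derivative_inner_left g)
  have "isCont h c" using h(1) has_derivative_continuous by blast
  then have "\<forall>\<^sub>F c' in at c. h c' \<in> S"
    using f(2) h(2) by (metis isCont_def topological_tendstoD)
  then show "\<forall>\<^sub>F c' in at c. (\<Sum>b\<in>Basis. (g c' \<bullet> b) *\<^sub>R D1 f (h c') b) = D1 f (h c') (g c')"
    by eventually_elim (metis D1_basis[OF f(1)])
  show "(\<Sum>b\<in>Basis. (g c \<bullet> b) *\<^sub>R D1 f (h c) b) = D1 f (h c) (g c)"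
    by (metis D1_basis[OF f(1) h(2)])
qed simp

lemma D2_basis:
  assumes f: "smooth_on S f" "open S" "x \<in> S"
  shows "D2 f x u v = (\<Sum>b\<in>Basis. (v \<bullet> b) *\<^sub>R D2 f x u b)"
  using D1_moving_basis[OF f(1,2) has_derivative_ident f(3) has_derivative_const, of v, THEN D1_eqI]
  by simp

text \<open>The product rule for the pairing of the derivative of \<open>f\<close>, taken at the moving point \<open>h c\<close>,
  with the moving vector \<open>g c\<close>. Differentiating tangent maps, Euler's identity and velocities
  along curves are all instances.\<close>

lemma D1_moving:
  assumes f: "smooth_on S f" "open S" and h: "(h has_derivative h') (at c)" "h c \<in> S"
    and g: "(g has_derivative g') (at c)"
  shows "((\<lambda>c. D1 f (h c) (g c)) has_derivative
    (\<lambda>p. D2 f (h c) (h' p) (g c) + D1 f (h c) (g' p))) (at c)"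
  using D1_moving_basis[OF assms]
  by (simp add: D2_basis[OF f h(2), where v = "g c"] D1_basis[OF f(1) h(2), where v = "g' _"] sum.distrib)

lemma linear_D1: "smooth_on S f \<Longrightarrow> x \<in> S \<Longrightarrow> linear (D1 f x)"
  using smooth_on_has_derivative has_derivative_linear by metis

lemma linear_D2_left: "smooth_on S f \<Longrightarrow> x \<in> S \<Longrightarrow> linear (\<lambda>u. D2 f x u v)"
  using linear_D1[OF smooth_on_D1] by blast

lemma linear_D2_right:
  assumes "smooth_on S f" "open S" "x \<in> S"
  shows "linear (\<lambda>v. D2 f x u v)"
proof (rule linearI)
  note D2_basis = D2_basis[OF assms, where u = u]
  fix v w :: 'a and k :: real
  show "D2 f x u (v + w) = D2 f x u v + D2 f x u w"
    unfolding D2_basis[of "v + w"] D2_basis[of v] D2_basis[of w]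
    by (simp add: inner_left_distrib scaleR_add_left sum.distrib)
  show "D2 f x u (k *\<^sub>R v) = k *\<^sub>R D2 f x u v"
    unfolding D2_basis[of "k *\<^sub>R v"] D2_basis[of v] by (simp add: scaleR_sum_right)
qed

text \<open>The left-hand side is symmetric in \<open>v\<close> and \<open>w\<close>, so \<open>D2\<close> in either order, taken at a nearby
  point, equals the same quotient. By continuity this makes \<open>D2\<close> symmetric.\<close>

lemma second_difference:
  fixes f :: "'a::euclidean_space \<Rightarrow> real"
  assumes f: "smooth_on (ball x r) f" and h: "h > 0" "h * norm v + h * norm w < r"
  shows "\<exists>y\<in>ball x r.
    f (x + h *\<^sub>R v + h *\<^sub>R w) - f (x + h *\<^sub>R v) - f (x + h *\<^sub>R w) + f x = h * h * D2 f y w v"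
proof -
  have small: "norm (s *\<^sub>R v + t *\<^sub>R w) \<le> h * norm v + h * norm w"
    if "0 \<le> s" "s \<le> h" "0 \<le> t" "t \<le> h" for s t
    using that by (intro norm_triangle_le add_mono) (auto intro: mult_right_mono)
  have dx: "dist x (x + a + b) = norm (a + b)" for a b
    unfolding add.assoc dist_commute[of x] by (simp add: dist_norm)
  have inb: "x + s *\<^sub>R v + t *\<^sub>R w \<in> ball x r" if "0 \<le> s" "s \<le> h" "0 \<le> t" "t \<le> h" for s t
    using small[OF that] h(2) by (simp add: dx)
  have inb0: "x + s *\<^sub>R v \<in> ball x r" if "0 \<le> s" "s \<le> h" for s
    using inb[OF that, of 0] h(1) by simp
  \<comment> \<open>Mean value theorem first in the direction \<open>v\<close>, then in the direction \<open>w\<close>.\<close>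
  let ?p = "\<lambda>s. f (x + s *\<^sub>R v + h *\<^sub>R w) - f (x + s *\<^sub>R v)"
  have d: "((\<lambda>s. f (x + s *\<^sub>R v + k)) has_real_derivative D1 f (x + s *\<^sub>R v + k) v) (at s)"
    if "x + s *\<^sub>R v + k \<in> ball x r" for s k
  proof -
    have "((\<lambda>s. x + s *\<^sub>R v + k) has_derivative (\<lambda>t. t *\<^sub>R v)) (at s)"
      by (auto intro!: derivative_eq_intros)
    from diff_chain_at[OF this smooth_on_has_derivative[OF f that]]
    have "((\<lambda>s. f (x + s *\<^sub>R v + k)) has_derivative (\<lambda>t. D1 f (x + s *\<^sub>R v + k) (t *\<^sub>R v))) (at s)"
      by (simp add: o_def)
    then show ?thesis
      by (simp add: has_field_derivative_def linear_scale[OF linear_D1[OF f that]] mult_commute_abs)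
  qed
  have "\<exists>s>0. s < h \<and> ?p h - ?p 0 = (h - 0) * (D1 f (x + s *\<^sub>R v + h *\<^sub>R w) v - D1 f (x + s *\<^sub>R v) v)"
    by (rule MVT2[OF h(1)]) (use inb inb0 d[of _ "h *\<^sub>R w"] d[of _ 0] h(1) in \<open>auto intro!: DERIV_diff\<close>)
  then obtain s where s: "0 < s" "s < h"
    "?p h - ?p 0 = h * (D1 f (x + s *\<^sub>R v + h *\<^sub>R w) v - D1 f (x + s *\<^sub>R v) v)" by auto
  let ?q = "\<lambda>t. D1 f (x + s *\<^sub>R v + t *\<^sub>R w) v"
  have e: "(?q has_real_derivative D2 f (x + s *\<^sub>R v + t *\<^sub>R w) w v) (at t)" if "0 \<le> t" "t \<le> h" for t
  proof -
    have i: "x + s *\<^sub>R v + t *\<^sub>R w \<in> ball x r" using inb s that by simp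
    have "((\<lambda>t. x + s *\<^sub>R v + t *\<^sub>R w) has_derivative (\<lambda>t. t *\<^sub>R w)) (at t)"
      by (auto intro!: derivative_eq_intros)
    from diff_chain_at[OF this smooth_on_has_derivative[OF smooth_on_D1[OF f] i]]
    have "(?q has_derivative (\<lambda>p. D2 f (x + s *\<^sub>R v + t *\<^sub>R w) (p *\<^sub>R w) v)) (at t)"
      by (simp add: o_def)
    then show ?thesis
      by (simp add: has_field_derivative_def linear_scale[OF linear_D2_left[OF f i]] mult_commute_abs)
  qed
  have "\<exists>t>0. t < h \<and> ?q h - ?q 0 = (h - 0) * D2 f (x + s *\<^sub>R v + t *\<^sub>R w) w v"
    by (rule MVT2[OF h(1)]) (use e in auto)
  then obtain t where t: "0 < t" "t < h" "?q h - ?q 0 = h * D2 f (x + s *\<^sub>R v + t *\<^sub>R w) w v" by auto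
  let ?y = "x + s *\<^sub>R v + t *\<^sub>R w"
  have "f (x + h *\<^sub>R v + h *\<^sub>R w) - f (x + h *\<^sub>R v) - f (x + h *\<^sub>R w) + f x = ?p h - ?p 0" by simp
  also have "\<dots> = h * (?q h - ?q 0)" using s(3) by simp
  also have "\<dots> = h * h * D2 f ?y w v" unfolding t(3) by simp
  finally show ?thesis
    using inb[of s t] s t by (intro bexI[of _ ?y]) auto
qed

lemma D2_sym_real:
  fixes f :: "'a::euclidean_space \<Rightarrow> real"
  assumes f: "smooth_on S f" "open S" "x \<in> S"
  shows "D2 f x v w = D2 f x w v"
proof (rule ccontr)
  assume ne: "D2 f x v w \<noteq> D2 f x w v"
  define e where "e = \<bar>D2 f x v w - D2 f x w v\<bar> / 2"
  have e: "e > 0" using ne by (simp add: e_def)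
  have near: "\<exists>d>0. \<forall>y. dist x y < d \<longrightarrow> \<bar>D2 f y a b - D2 f x a b\<bar> < e" for a b
  proof -
    have "continuous_on S (\<lambda>y. D2 f y a b)"
      by (rule smooth_on_continuous_on[OF smooth_on_D1[OF smooth_on_D1[OF f(1)]]])
    then have "isCont (\<lambda>y. D2 f y a b) x" using f(2,3) continuous_on_eq_continuous_at by blast
    then show ?thesis using e unfolding continuous_at_eps_delta by (metis dist_commute dist_real_def)
  qed
  obtain d1 where d1: "d1 > 0" "\<And>y. dist x y < d1 \<Longrightarrow> \<bar>D2 f y v w - D2 f x v w\<bar> < e" using near by metis
  obtain d2 where d2: "d2 > 0" "\<And>y. dist x y < d2 \<Longrightarrow> \<bar>D2 f y w v - D2 f x w v\<bar> < e" using near by metis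
  obtain d3 where d3: "d3 > 0" "ball x d3 \<subseteq> S" using f(2,3) open_contains_ball by blast
  define r where "r = min d1 (min d2 d3)"
  have r: "r > 0" using d1 d2 d3 by (simp add: r_def)
  have fr: "smooth_on (ball x r) f" by (rule smooth_on_subset[OF f(1)]) (use d3(2) in \<open>auto simp: r_def\<close>)
  define h where "h = r / (norm v + norm w + 1)"
  have np: "norm v + norm w + 1 > 0" by (simp add: add_nonneg_pos)
  have h: "h > 0" using r np by (simp add: h_def)
  have hr: "h * norm v + h * norm w < r"
  proof -
    have "h * norm v + h * norm w < h * (norm v + norm w + 1)" using h by (simp add: algebra_simps)
    also have "\<dots> = r" using np by (simp add: h_def)
    finally show ?thesis .
  qed
  then have hr': "h * norm w + h * norm v < r" by simp
  obtain y where y: "dist x y < r"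
    "f (x + h *\<^sub>R v + h *\<^sub>R w) - f (x + h *\<^sub>R v) - f (x + h *\<^sub>R w) + f x = h * h * D2 f y w v"
    using second_difference[OF fr h hr] by (meson mem_ball)
  obtain y' where y': "dist x y' < r"
    "f (x + h *\<^sub>R w + h *\<^sub>R v) - f (x + h *\<^sub>R w) - f (x + h *\<^sub>R v) + f x = h * h * D2 f y' v w"
    using second_difference[OF fr h hr'] by (meson mem_ball)
  have "f (x + h *\<^sub>R w + h *\<^sub>R v) = f (x + h *\<^sub>R v + h *\<^sub>R w)"
    by (simp add: add.commute add.left_commute)
  then have "h * h * D2 f y w v = h * h * D2 f y' v w" using y(2) y'(2) by linarith
  then have "D2 f y w v = D2 f y' v w" using h by simp
  moreover have "\<bar>D2 f y w v - D2 f x w v\<bar> < e" "\<bar>D2 f y' v w - D2 f x v w\<bar> < e"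
    using d1(2) d2(2) y(1) y'(1) by (auto simp: r_def)
  ultimately have "\<bar>D2 f x v w - D2 f x w v\<bar> < 2 * e" by linarith
  then show False by (simp add: e_def)
qed

lemma D1_inner:
  assumes "smooth_on S f" "x \<in> S"
  shows "D1 (\<lambda>x. f x \<bullet> b) x v = D1 f x v \<bullet> b"
  by (rule D1_eqI) (rule has_derivative_inner_left[OF smooth_on_has_derivative[OF assms]])

theorem D2_sym:
  fixes f :: "'a::euclidean_space \<Rightarrow> 'b::euclidean_space"
  assumes f: "smooth_on S f" "open S" "x \<in> S"
  shows "D2 f x v w = D2 f x w v"
proof (rule euclidean_eqI)
  fix b :: 'b
  have sb: "smooth_on S (\<lambda>x. f x \<bullet> b)"
    using f by (auto simp: smooth_on_def intro: C_k_bounded_linear[OF bounded_linear_inner_left])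
  have eq: "D2 (\<lambda>x. f x \<bullet> b) x v w = D2 f x v w \<bullet> b" for v w
  proof (rule D1_eqI, rule has_derivative_transform_within_open[OF _ f(2,3)])
    show "((\<lambda>z. D1 f z w \<bullet> b) has_derivative (\<lambda>v. D2 f x v w \<bullet> b)) (at x)"
      by (rule has_derivative_inner_left[OF smooth_on_has_derivative[OF smooth_on_D1[OF f(1)] f(3)]])
  qed (simp add: D1_inner[OF f(1)])
  show "D2 f x v w \<bullet> b = D2 f x w v \<bullet> b"
    using D2_sym_real[OF sb f(2,3), where v = v and w = w] unfolding eq .
qed

section \<open>Constructions with smooth maps\<close>

lemma open_Times_nonzero:
  fixes S :: "'a::topological_space set"
  assumes "open S"
  shows "open (S \<times> {y::'b::t1_space. y \<noteq> c})"
proof -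
  have "{y::'b. y \<noteq> c} = - {c}" by auto
  then show ?thesis using assms by (simp add: open_Times open_Compl)
qed

lemma smooth_on_ident: "smooth_on S (\<lambda>x. x)" if "open S"
  unfolding smooth_on_def
proof
  fix k show "C_k k S (\<lambda>x. x)"
    by (cases k) (auto intro!: C_k_SucI[OF that has_derivative_ident] C_k_const)
qed

lemma smooth_on_linear: "bounded_linear h \<Longrightarrow> open S \<Longrightarrow> smooth_on S f \<Longrightarrow> smooth_on S (\<lambda>x. h (f x))"
  by (auto simp: smooth_on_def intro: C_k_bounded_linear)

lemma smooth_on_const: "smooth_on S (\<lambda>x. c)"
  by (simp add: smooth_on_def C_k_const)

lemma smooth_on_add: "open S \<Longrightarrow> smooth_on S f \<Longrightarrow> smooth_on S g \<Longrightarrow> smooth_on S (\<lambda>x. f x + g x)"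
  by (simp add: smooth_on_def C_k_add)

lemma smooth_on_scaleR:
  "open S \<Longrightarrow> smooth_on S f \<Longrightarrow> smooth_on S g \<Longrightarrow> smooth_on S (\<lambda>x. f x *\<^sub>R g x)"
  by (simp add: smooth_on_def C_k_scaleR)

lemma smooth_on_minus: "open S \<Longrightarrow> smooth_on S f \<Longrightarrow> smooth_on S (\<lambda>x. - f x)"
  by (rule smooth_on_linear[OF bounded_linear_minus[OF bounded_linear_ident]])

lemma smooth_on_diff: "open S \<Longrightarrow> smooth_on S f \<Longrightarrow> smooth_on S g \<Longrightarrow> smooth_on S (\<lambda>x. f x - g x)"
  using smooth_on_add[OF _ _ smooth_on_minus] by simp

lemma smooth_on_mult:
  fixes f g :: "'a::euclidean_space \<Rightarrow> real"
  shows "open S \<Longrightarrow> smooth_on S f \<Longrightarrow> smooth_on S g \<Longrightarrow> smooth_on S (\<lambda>x. f x * g x)"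
  using smooth_on_scaleR by fastforce

lemma smooth_on_sum:
  "open S \<Longrightarrow> finite B \<Longrightarrow> (\<And>b. b \<in> B \<Longrightarrow> smooth_on S (f b)) \<Longrightarrow> smooth_on S (\<lambda>x. \<Sum>b\<in>B. f b x)"
  by (simp add: smooth_on_def C_k_sum)

lemma smooth_on_cong: "open S \<Longrightarrow> (\<And>x. x \<in> S \<Longrightarrow> f x = g x) \<Longrightarrow> smooth_on S f \<Longrightarrow> smooth_on S g"
  unfolding smooth_on_def using C_k_cong by blast

lemma smooth_on_compose:
  fixes f :: "'a::euclidean_space \<Rightarrow> 'b::euclidean_space" and g :: "'b \<Rightarrow> 'c::real_normed_vector"
  assumes "open S" "smooth_on S f" "smooth_on T g" "\<And>x. x \<in> S \<Longrightarrow> f x \<in> T"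
  shows "smooth_on S (\<lambda>x. g (f x))"
  using C_k_compose[of S f T _ g] assms unfolding smooth_on_def o_def by (meson image_subsetI)

lemma smooth_on_Pair:
  fixes f :: "'a::euclidean_space \<Rightarrow> 'b::euclidean_space" and g :: "'a \<Rightarrow> 'c::euclidean_space"
  assumes "open S" "smooth_on S f" "smooth_on S g"
  shows "smooth_on S (\<lambda>x. (f x, g x))"
proof -
  have "bounded_linear (\<lambda>y::'b. (y, 0::'c))" "bounded_linear (\<lambda>y::'c. (0::'b, y))"
    by (auto intro: bounded_linear_Pair bounded_linear_ident bounded_linear_zero)
  then have "smooth_on S (\<lambda>x. (f x, 0) + (0, g x))"
    using assms by (intro smooth_on_add smooth_on_linear[where h = "\<lambda>y. (y, 0)"] smooth_on_linear[where h = "\<lambda>y. (0, y)"])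
  then show ?thesis by simp
qed

lemma smooth_on_fst: "open S \<Longrightarrow> smooth_on S fst"
  using smooth_on_linear[OF bounded_linear_fst _ smooth_on_ident] by blast

lemma smooth_on_snd: "open S \<Longrightarrow> smooth_on S snd"
  using smooth_on_linear[OF bounded_linear_snd _ smooth_on_ident] by blast

text \<open>Smoothness is a statement about fixed directions; here it is jointly in point and direction.\<close>

lemma smooth_on_tangent_map:
  assumes f: "smooth_on S f" "open S"
  shows "smooth_on (S \<times> UNIV) (\<lambda>p. D1 f (fst p) (snd p))"
proof (rule smooth_on_cong)
  have o: "open (S \<times> (UNIV :: 'a set))" using f(2) by (simp add: open_Times)
  have "smooth_on (S \<times> (UNIV :: 'a set)) (\<lambda>p. D1 f (fst p) b)" for b
    using smooth_on_compose[OF o smooth_on_fst[OF o] smooth_on_D1[OF f(1), of b]] by auto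
  moreover have "smooth_on (S \<times> UNIV) (\<lambda>p. snd p \<bullet> b)" for b :: 'a
    by (rule smooth_on_linear[OF bounded_linear_inner_left o smooth_on_snd[OF o]])
  ultimately show "smooth_on (S \<times> UNIV) (\<lambda>p. \<Sum>b\<in>Basis. (snd p \<bullet> b) *\<^sub>R D1 f (fst p) b)"
    by (intro smooth_on_sum smooth_on_scaleR o finite_Basis)
  show "open (S \<times> (UNIV :: 'a set))" by (rule o)
  show "(\<Sum>b\<in>Basis. (snd p \<bullet> b) *\<^sub>R D1 f (fst p) b) = D1 f (fst p) (snd p)" if "p \<in> S \<times> UNIV" for p
    using that by (metis D1_basis[OF f(1)] mem_Times_iff)
qed

section \<open>Ordinary differential equations with Lipschitz right-hand side\<close>

text \<open>Local existence follows from Banach's fixed point theorem for the integral operator on the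
  space of bounded continuous curves.\<close>

lemma picard_lindelof:
  fixes f :: "'a::euclidean_space \<Rightarrow> 'a"
  assumes r: "r > 0" and K: "K-lipschitz_on (cball z0 r) f"
  shows "\<exists>\<epsilon>>0. \<exists>z. z 0 = z0 \<and>
    (\<forall>t\<in>{-\<epsilon><..<\<epsilon>}. z t \<in> cball z0 r \<and> (z has_vector_derivative f (z t)) (at t))"
proof -
  \<comment> \<open>Composing with the projection to the ball makes the right-hand side bounded and Lipschitz on
    the whole space, so that the integral operator acts on all bounded continuous curves.\<close>
  define P where "P = closest_point (cball z0 r)"
  define h where "h = (\<lambda>z. f (P z))"
  have cb: "closed (cball z0 r)" "convex (cball z0 r)" "cball z0 r \<noteq> {}" using r by auto
  have P: "P z \<in> cball z0 r" for z unfolding P_def by (rule closest_point_in_set[OF cb(1,3)])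
  have K0: "K \<ge> 0" by (rule lipschitz_on_nonneg[OF K])
  have h: "norm (h x - h y) \<le> K * norm (x - y)" for x y
  proof -
    have "norm (h x - h y) \<le> K * norm (P x - P y)"
      unfolding h_def by (rule lipschitz_on_normD[OF K P P])
    also have "\<dots> \<le> K * norm (x - y)"
      using closest_point_lipschitz[OF cb(2,1,3), of x y]
      by (intro mult_left_mono K0) (simp add: P_def dist_norm)
    finally show ?thesis .
  qed
  have cont: "continuous_on UNIV h"
    by (rule lipschitz_on_continuous_on[of K]) (auto intro!: lipschitz_onI K0 simp: dist_norm h)
  obtain M where M: "M > 0" "\<And>x. norm (h x) \<le> M"
  proof -
    have "compact (f ` cball z0 r)"
      by (intro compact_continuous_image lipschitz_on_continuous_on[OF K] compact_cball)
    then have "bounded (f ` cball z0 r)" by (rule compact_imp_bounded)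
    then obtain M where "M > 0" "\<And>x. x \<in> cball z0 r \<Longrightarrow> norm (f x) \<le> M" by (auto simp: bounded_pos)
    then show ?thesis using that P by (metis h_def)
  qed
  \<comment> \<open>The first bound keeps solutions in the ball, the second makes the Picard operator contract by \<open>1/4\<close>.\<close>
  define \<epsilon> where "\<epsilon> = min (r / M) (1 / (4 * (K + 1)))"
  have e: "\<epsilon> > 0" "\<epsilon> * M \<le> r" "\<epsilon> * K \<le> 1/4"
  proof -
    show "\<epsilon> > 0" using r M(1) K0 by (simp add: \<epsilon>_def)
    have "\<epsilon> * M \<le> r / M * M" by (rule mult_right_mono) (use M(1) in \<open>auto simp: \<epsilon>_def\<close>)
    then show "\<epsilon> * M \<le> r" using M(1) by simp
    have "\<epsilon> * K \<le> 1 / (4 * (K + 1)) * K" by (rule mult_right_mono) (use K0 in \<open>auto simp: \<epsilon>_def\<close>)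
    also have "\<dots> \<le> 1/4" using K0 by (simp add: field_simps)
    finally show "\<epsilon> * K \<le> 1/4" .
  qed
  define J where "J = (\<lambda>(g::real \<Rightarrow> 'a) t. integral {-\<epsilon>..t} g - integral {-\<epsilon>..0} g)"
  \<comment> \<open>Freezing curves outside \<open>[-\<epsilon>, \<epsilon>]\<close> turns them into bounded continuous functions on the whole line.\<close>
  define cl where "cl = (\<lambda>t. max (-\<epsilon>) (min \<epsilon> t))"
  have cl: "cl t \<in> {-\<epsilon>..\<epsilon>}" for t using e(1) by (auto simp: cl_def)
  have Jd: "(J g has_vector_derivative g t) (at t within {-\<epsilon>..\<epsilon>})"
    if "continuous_on UNIV g" "t \<in> {-\<epsilon>..\<epsilon>}" for g t
    unfolding J_def
    using integral_has_vector_derivative[OF continuous_on_subset[OF that(1) subset_UNIV] that(2)]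
    by (auto intro!: derivative_eq_intros)
  have J0: "J g 0 = 0" for g by (simp add: J_def)
  have J_bound: "norm (J g t) \<le> \<epsilon> * B"
    if g: "continuous_on UNIV g" and t: "t \<in> {-\<epsilon>..\<epsilon>}" and B: "\<And>s. norm (g s) \<le> B" for g t B
  proof -
    have B0: "B \<ge> 0" using B[of 0] norm_ge_zero order_trans by blast
    have "norm (J g t - J g 0) \<le> B * norm (t - 0)"
    proof (rule differentiable_bound[where S = "{-\<epsilon>..\<epsilon>}" and f' = "\<lambda>s d. d *\<^sub>R g s"])
      show "(J g has_derivative (\<lambda>d. d *\<^sub>R g s)) (at s within {-\<epsilon>..\<epsilon>})" if "s \<in> {-\<epsilon>..\<epsilon>}" for s
        using Jd[OF g that] by (simp add: has_vector_derivative_def)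
      show "onorm (\<lambda>d. d *\<^sub>R g s) \<le> B" for s
        using B[of s] by (intro onorm_le) (simp add: mult.commute[of B] mult_left_mono)
    qed (use t e(1) in auto)
    also have "\<dots> \<le> B * \<epsilon>" using t by (intro mult_left_mono B0) auto
    finally show ?thesis by (simp add: J0 mult.commute)
  qed
  have J_diff: "J g t - J g' t = J (\<lambda>s. g s - g' s) t"
    if "continuous_on UNIV g" "continuous_on UNIV g'" for g g' t
  proof -
    have "g integrable_on {a..b}" "g' integrable_on {a..b}" for a b
      using that by (auto intro!: integrable_continuous_real intro: continuous_on_subset)
    then show ?thesis by (simp add: J_def integral_diff)
  qed
  define T where "T = (\<lambda>(z::real \<Rightarrow>\<^sub>C 'a). Bcontfun (\<lambda>t. z0 + J (\<lambda>s. h (z s)) (cl t)))"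
  have hz: "continuous_on UNIV (\<lambda>s. h (apply_bcontfun z s))" for z :: "real \<Rightarrow>\<^sub>C 'a"
    by (rule continuous_on_compose2[OF cont]) auto
  have T: "apply_bcontfun (T z) t = z0 + J (\<lambda>s. h (z s)) (cl t)" for z t
  proof -
    have "continuous_on {-\<epsilon>..\<epsilon>} (J (\<lambda>s. h (z s)))"
      unfolding continuous_on_eq_continuous_within using has_vector_derivative_continuous[OF Jd[OF hz]] by blast
    moreover have "continuous_on UNIV cl" unfolding cl_def by (intro continuous_intros)
    ultimately have "continuous_on UNIV (\<lambda>t. J (\<lambda>s. h (z s)) (cl t))"
      by (rule continuous_on_compose2) (use cl in auto)
    then have "continuous_on UNIV (\<lambda>t. z0 + J (\<lambda>s. h (z s)) (cl t))"
      by (intro continuous_on_add continuous_on_const)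
    moreover have "norm (z0 + J (\<lambda>s. h (z s)) (cl t)) \<le> norm z0 + \<epsilon> * M" for t
      by (intro norm_triangle_le add_mono order_refl J_bound hz cl M)
    ultimately have "(\<lambda>t. z0 + J (\<lambda>s. h (z s)) (cl t)) \<in> bcontfun" by (rule bcontfun_normI)
    then show ?thesis unfolding T_def by (simp add: Bcontfun_inverse)
  qed
  have "\<exists>!z. T z = z"
  proof (rule banach_fix_type)
    show "\<forall>x y. dist (T x) (T y) \<le> 1/4 * dist x y"
    proof (intro allI dist_bound)
      fix x y :: "real \<Rightarrow>\<^sub>C 'a" and t
      have "dist (T x t) (T y t) = norm (J (\<lambda>s. h (x s) - h (y s)) (cl t))"
        by (simp add: T dist_norm J_diff[OF hz hz])
      also have "\<dots> \<le> \<epsilon> * (K * dist x y)"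
      proof (rule J_bound[OF _ cl])
        show "continuous_on UNIV (\<lambda>s. h (x s) - h (y s))" by (intro continuous_intros hz)
        fix s
        have "norm (h (x s) - h (y s)) \<le> K * norm (x s - y s)" by (rule h)
        also have "\<dots> \<le> K * dist x y"
          using dist_bounded[of x s y] by (intro mult_left_mono K0) (simp add: dist_norm)
        finally show "norm (h (x s) - h (y s)) \<le> K * dist x y" .
      qed
      also have "\<dots> \<le> 1/4 * dist x y"
        using mult_right_mono[OF e(3), of "dist x y"] by (simp add: mult.assoc)
      finally show "dist (T x t) (T y t) \<le> 1/4 * dist x y" .
    qed
  qed auto
  then obtain z where z: "T z = z" by blast
  have zt: "z t = z0 + J (\<lambda>s. h (z s)) (cl t)" for t using T[of z t] by (simp add: z)
  have clt: "cl t = t" if "t \<in> {-\<epsilon>..\<epsilon>}" for t using that by (auto simp: cl_def)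
  show ?thesis
  proof (intro exI[of _ \<epsilon>] exI[of _ "apply_bcontfun z"] conjI ballI e(1))
    show "z 0 = z0" using e(1) by (simp add: zt[of 0] clt J0)
    fix t assume t: "t \<in> {-\<epsilon><..<\<epsilon>}"
    have "norm (J (\<lambda>s. h (z s)) (cl t)) \<le> \<epsilon> * M" by (intro J_bound hz cl M)
    then show in_ball: "z t \<in> cball z0 r" using e(2) by (simp add: zt[of t] dist_norm)
    have "((\<lambda>t. z0 + J (\<lambda>s. h (z s)) t) has_vector_derivative h (z t)) (at t within {-\<epsilon>..\<epsilon>})"
      using Jd[OF hz, of t z] t by (auto intro!: derivative_eq_intros)
    then have "((\<lambda>t. z0 + J (\<lambda>s. h (z s)) t) has_vector_derivative h (z t)) (at t within {-\<epsilon><..<\<epsilon>})"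
      by (rule has_vector_derivative_within_subset) auto
    then have "((\<lambda>t. z0 + J (\<lambda>s. h (z s)) t) has_vector_derivative h (z t)) (at t)"
      unfolding at_within_open[OF t open_greaterThanLessThan] .
    moreover have "z0 + J (\<lambda>s. h (z s)) t = z t" if "t \<in> {-\<epsilon><..<\<epsilon>}" for t
      using that by (simp add: zt[of t] clt)
    ultimately have "(z has_vector_derivative h (z t)) (at t)"
      by (rule has_vector_derivative_transform_within_open[OF _ open_greaterThanLessThan t])
    moreover have "h (z t) = f (z t)" using in_ball by (simp add: h_def P_def closest_point_self)
    ultimately show "(z has_vector_derivative f (z t)) (at t)" by simp
  qed
qed

section \<open>Positive definite linear systems with parameters\<close>

text \<open>On a compact set the derivatives in the finitely many basis directions are bounded, and
  convexity lets the mean value inequality apply between any two points.\<close>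

lemma smooth_on_imp_lipschitz_on:
  fixes f :: "'a::euclidean_space \<Rightarrow> 'b::real_normed_vector"
  assumes f: "smooth_on S f" and K: "compact K" "convex K" "K \<subseteq> S"
  shows "\<exists>C. C-lipschitz_on K f"
proof -
  have "\<exists>C. \<forall>x\<in>K. norm (D1 f x b) \<le> C" for b
  proof -
    have "compact ((\<lambda>x. D1 f x b) ` K)"
      by (intro compact_continuous_image K(1) continuous_on_subset[OF _ K(3)]
          smooth_on_continuous_on smooth_on_D1 f)
    then have "bounded ((\<lambda>x. D1 f x b) ` K)" by (rule compact_imp_bounded)
    then show ?thesis by (auto simp: bounded_iff)
  qed
  then obtain C where C: "\<And>b x. x \<in> K \<Longrightarrow> norm (D1 f x b) \<le> C b" by metis
  show ?thesis
  proof (rule exI, rule bounded_derivative_imp_lipschitz[OF _ K(2)])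
    fix x assume x: "x \<in> K"
    then have xS: "x \<in> S" using K by auto
    show "(f has_derivative D1 f x) (at x within K)"
      by (rule has_derivative_at_withinI) (use smooth_on_has_derivative[OF f xS] in simp)
    show "onorm (D1 f x) \<le> (\<Sum>b\<in>Basis. \<bar>C b\<bar>)"
    proof (rule onorm_le)
      fix v
      have "norm (D1 f x v) \<le> (\<Sum>b\<in>Basis. norm ((v \<bullet> b) *\<^sub>R D1 f x b))"
        unfolding D1_basis[OF f xS, of v] by (rule norm_sum)
      also have "\<dots> \<le> (\<Sum>b\<in>Basis. \<bar>C b\<bar> * norm v)"
      proof (rule sum_mono)
        fix b :: 'a assume b: "b \<in> Basis"
        have "norm ((v \<bullet> b) *\<^sub>R D1 f x b) = norm (D1 f x b) * \<bar>v \<bullet> b\<bar>" by simp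
        also have "\<dots> \<le> \<bar>C b\<bar> * norm v"
          using C[OF x, of b] Basis_le_norm[OF b, of v] by (intro mult_mono) auto
        finally show "norm ((v \<bullet> b) *\<^sub>R D1 f x b) \<le> \<bar>C b\<bar> * norm v" .
      qed
      finally show "norm (D1 f x v) \<le> (\<Sum>b\<in>Basis. \<bar>C b\<bar>) * norm v" by (simp add: sum_distrib_right)
    qed
  qed (simp add: sum_nonneg)
qed

text \<open>This provides the Lipschitz condition for the geodesic equations solved for the acceleration.
  Comparing the systems at two parameters avoids inverting them: coercivity bounds the difference of
  the solutions by the variation of \<open>G\<close> and \<open>R\<close>, which are Lipschitz on compact convex sets.\<close>

lemma lipschitz_solution_of_positive_definite_system:
  fixes G :: "'a::euclidean_space \<times> 'b::euclidean_space \<Rightarrow> 'b"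
  assumes G: "smooth_on (S \<times> UNIV) G" and lin: "\<And>z. z \<in> K \<Longrightarrow> linear (\<lambda>\<xi>. G (z, \<xi>))"
    and pos: "\<And>z \<xi>. z \<in> K \<Longrightarrow> \<xi> \<noteq> 0 \<Longrightarrow> G (z, \<xi>) \<bullet> \<xi> > 0"
    and R: "smooth_on S R" and a: "\<And>z. z \<in> K \<Longrightarrow> G (z, a z) = R z"
    and K: "compact K" "convex K" "K \<subseteq> S"
  shows "\<exists>C. C-lipschitz_on K a"
proof -
  \<comment> \<open>By compactness of \<open>K\<close> and of the unit sphere the forms are uniformly coercive.\<close>
  have "\<exists>l>0. \<forall>z\<in>K. \<forall>\<xi>. l * (norm \<xi> * norm \<xi>) \<le> G (z, \<xi>) \<bullet> \<xi>"
  proof (cases "K = {}")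
    case False
    let ?U = "K \<times> sphere (0::'b) 1"
    have "continuous_on ?U G"
      by (rule continuous_on_subset[OF smooth_on_continuous_on[OF G]]) (use K in auto)
    then have "continuous_on ?U (\<lambda>p. G p \<bullet> snd p)"
      by (intro continuous_on_inner continuous_on_snd continuous_on_id)
    moreover have "compact ?U" using K by (intro compact_Times compact_sphere)
    moreover have "?U \<noteq> {}" using False by auto
    ultimately obtain p where p: "p \<in> ?U" "\<And>q. q \<in> ?U \<Longrightarrow> G p \<bullet> snd p \<le> G q \<bullet> snd q"
      using continuous_attains_inf[of ?U "\<lambda>p. G p \<bullet> snd p"] by blast
    show ?thesis
    proof (intro exI[of _ "G p \<bullet> snd p"] conjI ballI allI)
      have "fst p \<in> K" "snd p \<noteq> 0" using p(1) by auto
      then show "G p \<bullet> snd p > 0" using pos[of "fst p" "snd p"] by simp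
      fix z \<xi> assume z: "z \<in> K"
      show "G p \<bullet> snd p * (norm \<xi> * norm \<xi>) \<le> G (z, \<xi>) \<bullet> \<xi>"
      proof (cases "\<xi> = 0")
        case False
        define \<eta> where "\<eta> = (1 / norm \<xi>) *\<^sub>R \<xi>"
        have xi: "\<xi> = norm \<xi> *\<^sub>R \<eta>" "norm \<eta> = 1" using False by (auto simp: \<eta>_def)
        have "G p \<bullet> snd p \<le> G (z, \<eta>) \<bullet> \<eta>" using p(2)[of "(z, \<eta>)"] z xi(2) by simp
        moreover have "G (z, \<xi>) = norm \<xi> *\<^sub>R G (z, \<eta>)"
          using linear_scale[OF lin[OF z], of "norm \<xi>" \<eta>] xi(1) by simp
        then have "G (z, \<xi>) \<bullet> \<xi> = (norm \<xi> * norm \<xi>) * (G (z, \<eta>) \<bullet> \<eta>)"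
          using xi(1) by (metis inner_scaleR_left inner_scaleR_right mult.assoc)
        ultimately show ?thesis by (simp add: mult.commute[of "G p \<bullet> snd p"] mult_left_mono)
      qed (use linear_0[OF lin[OF z]] in simp)
    qed
  qed (auto intro: exI[of _ 1])
  then obtain l where l: "l > 0" "\<And>z \<xi>. z \<in> K \<Longrightarrow> l * (norm \<xi> * norm \<xi>) \<le> G (z, \<xi>) \<bullet> \<xi>" by blast
  have coercive: "l * norm \<xi> \<le> norm (G (z, \<xi>))" if "z \<in> K" for z \<xi>
  proof (cases "\<xi> = 0")
    case False
    have "l * norm \<xi> * norm \<xi> \<le> norm (G (z, \<xi>)) * norm \<xi>"
      using l(2)[OF that, of \<xi>] norm_cauchy_schwarz[of "G (z, \<xi>)" \<xi>] by (simp add: mult.assoc)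
    then show ?thesis using False by simp
  qed simp
  have "compact (R ` K)"
    by (intro compact_continuous_image K(1) continuous_on_subset[OF smooth_on_continuous_on[OF R] K(3)])
  then have "bounded (R ` K)" by (rule compact_imp_bounded)
  then obtain M where M: "\<And>z. z \<in> K \<Longrightarrow> norm (R z) \<le> M" by (auto simp: bounded_iff)
  have a_bound: "norm (a z) \<le> M / l" if "z \<in> K" for z
    using coercive[OF that, of "a z"] M[OF that] a[OF that] l(1) by (simp add: field_simps)
  let ?KM = "K \<times> cball (0::'b) (M / l)"
  have "\<exists>C. C-lipschitz_on ?KM G"
    by (rule smooth_on_imp_lipschitz_on[OF G]) (use K in \<open>auto intro!: compact_Times convex_Times\<close>)
  then obtain C where C: "C-lipschitz_on ?KM G" ..
  obtain C' where C': "C'-lipschitz_on K R" using smooth_on_imp_lipschitz_on[OF R K] ..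
  show ?thesis
  proof (rule exI, rule lipschitz_onI)
    show "0 \<le> (C + C') / l" using lipschitz_on_nonneg[OF C] lipschitz_on_nonneg[OF C'] l(1) by simp
    fix z z' assume z: "z \<in> K" and z': "z' \<in> K"
    \<comment> \<open>Subtracting the systems at \<open>z\<close> and \<open>z'\<close> leaves a system at \<open>z\<close> for the difference.\<close>
    have "G (z, a z - a z') = R z - G (z, a z')"
      using linear_diff[OF lin[OF z], of "a z" "a z'"] a[OF z] by simp
    also have "\<dots> = (R z - R z') + (G (z', a z') - G (z, a z'))" using a[OF z'] by simp
    finally have "norm (G (z, a z - a z')) \<le> norm (R z - R z') + norm (G (z', a z') - G (z, a z'))"
      by (metis norm_triangle_ineq)
    also have "norm (R z - R z') \<le> C' * dist z z'"
      using lipschitz_onD[OF C' z z'] by (simp add: dist_norm)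
    also have "norm (G (z', a z') - G (z, a z')) \<le> C * dist z z'"
      using lipschitz_onD[OF C, of "(z', a z')" "(z, a z')"] z z' a_bound[OF z']
      by (simp add: dist_norm[symmetric] dist_Pair_Pair dist_commute)
    finally have "l * norm (a z - a z') \<le> (C + C') * dist z z'"
      using coercive[OF z, of "a z - a z'"] by (simp add: algebra_simps)
    then show "dist (a z) (a z') \<le> (C + C') / l * dist z z'"
      using l(1) by (simp add: dist_norm field_simps)
  qed
qed

section \<open>Finsler functions in coordinates\<close>

text \<open>This is the Euler-Lagrange equation \<open>d/dt (\<partial>F/\<partial>y) = \<partial>F/\<partial>x\<close> with the time derivative carried out by the
  chain rule along a curve with velocity \<open>y\<close> and acceleration \<open>a\<close>, paired with a vector \<open>w\<close>.\<close>

definition euler_lagrange_acc :: "('a::euclidean_space \<times> 'a \<Rightarrow> real) \<Rightarrow> 'a \<Rightarrow> 'a \<Rightarrow> 'a \<Rightarrow> bool" where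
  "euler_lagrange_acc F x y a \<longleftrightarrow> (\<forall>w. D2 F (x, y) (y, a) (0, w) = D1 F (x, y) (w, 0))"

lemma inner_sum_Basis_linear:
  fixes h :: "'a::euclidean_space \<Rightarrow> real"
  assumes "linear h"
  shows "(\<Sum>b\<in>Basis. h b *\<^sub>R b) \<bullet> w = h w"
proof -
  have "h w = h (\<Sum>b\<in>Basis. (w \<bullet> b) *\<^sub>R b)" by (simp add: euclidean_representation)
  also have "\<dots> = (\<Sum>b\<in>Basis. (w \<bullet> b) * h b)"
    by (simp add: linear_sum[OF assms] linear_scale[OF assms])
  finally show ?thesis by (simp add: inner_sum_left inner_commute[of w] mult.commute)
qed

lemma linear_vertical: "linear h \<Longrightarrow> linear (\<lambda>w. h (0, w))"
  using linear_compose[of "\<lambda>w. (0, w)" h] by (simp add: o_def linear_iff)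

lemma linear_horizontal: "linear h \<Longrightarrow> linear (\<lambda>w. h (w, 0))"
  using linear_compose[of "\<lambda>w. (w, 0)" h] by (simp add: o_def linear_iff)

text \<open>A Finsler function on the tangent bundle of an open set. The last assumption is positive
  definiteness of the fundamental tensor, up to the factor \<open>1/2\<close>.\<close>

locale local_finsler =
  fixes S :: "'a::euclidean_space set" and F :: "'a \<times> 'a \<Rightarrow> real"
  assumes open_S: "open S"
    and smooth_F: "smooth_on (S \<times> {y. y \<noteq> 0}) F"
    and homogeneous: "\<lbrakk>x \<in> S; y \<noteq> 0; k > 0\<rbrakk> \<Longrightarrow> F (x, k *\<^sub>R y) = k * F (x, y)"
    and F_pos: "\<lbrakk>x \<in> S; y \<noteq> 0\<rbrakk> \<Longrightarrow> F (x, y) > 0"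
    and pos_def: "\<lbrakk>x \<in> S; y \<noteq> 0; \<xi> \<noteq> 0\<rbrakk> \<Longrightarrow> D2 (\<lambda>z. (F z)\<^sup>2) (x, y) (0, \<xi>) (0, \<xi>) > 0"
begin

abbreviation "W \<equiv> S \<times> {y::'a. y \<noteq> 0}"
abbreviation "E \<equiv> (\<lambda>z. (F z)\<^sup>2)"

lemma open_W: "open W"
  by (rule open_Times_nonzero[OF open_S])

lemma smooth_E: "smooth_on W E"
  unfolding power2_eq_square by (intro smooth_on_mult open_W smooth_F)

text \<open>Euler's identity for functions homogeneous of degree one: differentiate
  \<open>F (x, k y) = k F (x, y)\<close> at \<open>k = 1\<close>.\<close>

lemma euler:
  assumes "x \<in> S" "y \<noteq> 0"
  shows "D1 F (x, y) (0, y) = F (x, y)"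
proof -
  have W: "(x, 1 *\<^sub>R y) \<in> W" using assms by simp
  have "((\<lambda>k. (x, k *\<^sub>R y)) has_derivative (\<lambda>d. (0, d *\<^sub>R y))) (at 1)"
    by (auto intro!: derivative_eq_intros)
  from diff_chain_at[OF this smooth_on_has_derivative[OF smooth_F W]]
  have 1: "((\<lambda>k. F (x, k *\<^sub>R y)) has_derivative (\<lambda>d. D1 F (x, y) (0, d *\<^sub>R y))) (at 1)"
    by (simp add: o_def)
  have "((\<lambda>k. k * F (x, y)) has_derivative (\<lambda>d. d * F (x, y))) (at 1)"
    by (auto intro!: derivative_eq_intros)
  then have "((\<lambda>k. F (x, k *\<^sub>R y)) has_derivative (\<lambda>d. d * F (x, y))) (at 1)"
    by (rule has_derivative_transform_within_open[of _ _ _ _ "{0<..}"]) (auto simp: homogeneous assms)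
  from fun_cong[OF has_derivative_unique[OF 1 this], of 1] show ?thesis by simp
qed

text \<open>Differentiate Euler's identity in the direction \<open>(p, q)\<close>; the terms with \<open>q\<close> cancel.\<close>

lemma euler_deriv:
  assumes "x \<in> S" "y \<noteq> 0"
  shows "D2 F (x, y) (p, q) (0, y) = D1 F (x, y) (p, 0)"
proof -
  have W: "(x, y) \<in> W" using assms by simp
  have "((\<lambda>z. (0, snd z)) has_derivative (\<lambda>z. (0, snd z))) (at (x, y))"
    by (auto intro!: derivative_eq_intros)
  from D1_moving[OF smooth_F open_W has_derivative_ident W this]
  have "((\<lambda>z. D1 F z (0, snd z)) has_derivative
      (\<lambda>p. D2 F (x, y) p (0, y) + D1 F (x, y) (0, snd p))) (at (x, y))" by simp
  then have "(F has_derivative (\<lambda>p. D2 F (x, y) p (0, y) + D1 F (x, y) (0, snd p))) (at (x, y))"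
    by (rule has_derivative_transform_within_open[OF _ open_W W]) (auto simp: euler)
  from D1_eqI[OF this, of "(p, q)"]
  have "D1 F (x, y) (p, q) = D2 F (x, y) (p, q) (0, y) + D1 F (x, y) (0, q)" by simp
  moreover have "D1 F (x, y) (p, q) = D1 F (x, y) (p, 0) + D1 F (x, y) (0, q)"
    using linear_add[OF linear_D1[OF smooth_F W], of "(p, 0)" "(0, q)"] by simp
  ultimately show ?thesis by simp
qed

lemma vertical_hessian_radial:
  assumes "x \<in> S" "y \<noteq> 0"
  shows "D2 F (x, y) (0, y) (0, w) = 0"
proof -
  have W: "(x, y) \<in> W" using assms by simp
  have "D2 F (x, y) (0, y) (0, w) = D2 F (x, y) (0, w) (0, y)" by (rule D2_sym[OF smooth_F open_W W])
  also have "\<dots> = D1 F (x, y) 0" using euler_deriv[OF assms, of 0 w] by (simp add: zero_prod_def)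
  also have "\<dots> = 0" by (rule linear_0[OF linear_D1[OF smooth_F W]])
  finally show ?thesis .
qed

lemma D1_E:
  assumes "z \<in> W"
  shows "D1 E z p = 2 * (F z * D1 F z p)"
proof -
  note d = smooth_on_has_derivative[OF smooth_F assms]
  show ?thesis unfolding power2_eq_square D1_eqI[OF has_derivative_mult[OF d d], of p] by (simp add: mult.commute)
qed

lemma D2_E:
  assumes "z \<in> W"
  shows "D2 E z p q = 2 * (D1 F z p * D1 F z q + F z * D2 F z p q)"
proof -
  have "((\<lambda>z. 2 * (F z * D1 F z q)) has_derivative
      (\<lambda>p. 2 * (F z * D2 F z p q + D1 F z p * D1 F z q))) (at z)"
    by (rule has_derivative_mult_right[OF has_derivative_mult[OF
        smooth_on_has_derivative[OF smooth_F assms]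
        smooth_on_has_derivative[OF smooth_on_D1[OF smooth_F] assms]]])
  then have "((\<lambda>z. D1 E z q) has_derivative
      (\<lambda>p. 2 * (F z * D2 F z p q + D1 F z p * D1 F z q))) (at z)"
    by (rule has_derivative_transform_within_open[OF _ open_W assms]) (simp add: D1_E)
  from D1_eqI[OF this] show ?thesis by simp
qed

text \<open>The Hessian of \<open>F\<^sup>2\<close> is twice the sum of \<open>F\<close> times the Hessian of \<open>F\<close> and the square of the
  derivative of \<open>F\<close>. Since it is positive definite, a null vector of the Hessian of \<open>F\<close> on
  which the derivative of \<open>F\<close> vanishes must be zero.\<close>

lemma vertical_hessian_kernel:
  assumes xy: "x \<in> S" "y \<noteq> 0" and 0: "\<And>w. D2 F (x, y) (0, \<xi>) (0, w) = 0"
  shows "\<exists>k. \<xi> = k *\<^sub>R y"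
proof -
  have W: "(x, y) \<in> W" using xy by simp
  \<comment> \<open>Subtract from \<open>\<xi>\<close> its component along \<open>y\<close>, so that the derivative of \<open>F\<close> in the remaining
    direction vanishes and the Hessians of \<open>F\<^sup>2\<close> and \<open>F\<close> agree on it up to a factor.\<close>
  define k where "k = D1 F (x, y) (0, \<xi>) / F (x, y)"
  let ?\<eta> = "\<xi> - k *\<^sub>R y"
  have pair: "(0, ?\<eta>) = (0, \<xi>) - k *\<^sub>R (0, y)" by simp
  have "D1 F (x, y) (0, ?\<eta>) = D1 F (x, y) (0, \<xi>) - k * D1 F (x, y) (0, y)"
    unfolding pair linear_diff[OF linear_D1[OF smooth_F W]] linear_scale[OF linear_D1[OF smooth_F W]] by simp
  then have 1: "D1 F (x, y) (0, ?\<eta>) = 0" using euler[OF xy] F_pos[OF xy] by (simp add: k_def)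
  have "D2 F (x, y) (0, ?\<eta>) w = D2 F (x, y) (0, \<xi>) w - k * D2 F (x, y) (0, y) w" for w
    unfolding pair linear_diff[OF linear_D2_left[OF smooth_F W]]
      linear_scale[OF linear_D2_left[OF smooth_F W]] by simp
  then have "D2 F (x, y) (0, ?\<eta>) (0, ?\<eta>) = 0" by (simp add: 0 vertical_hessian_radial[OF xy])
  then have "D2 E (x, y) (0, ?\<eta>) (0, ?\<eta>) = 0" unfolding D2_E[OF W] 1 by simp
  then have "?\<eta> = 0" using pos_def[OF xy, of ?\<eta>] by force
  then show ?thesis by auto
qed

text \<open>The equations are affine in the acceleration, with the vertical Hessian as linear part.\<close>

lemma euler_lagrange_acc_unique:
  assumes xy: "x \<in> S" "y \<noteq> 0" and "euler_lagrange_acc F x y a" "euler_lagrange_acc F x y b"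
  shows "\<exists>k. a - b = k *\<^sub>R y"
proof (rule vertical_hessian_kernel[OF xy])
  fix w
  have W: "(x, y) \<in> W" using xy by simp
  have "(0, a - b) = (y, a) - (y, b)" by simp
  then have "D2 F (x, y) (0, a - b) (0, w) = D2 F (x, y) (y, a) (0, w) - D2 F (x, y) (y, b) (0, w)"
    using linear_diff[OF linear_D2_left[OF smooth_F W]] by metis
  then show "D2 F (x, y) (0, a - b) (0, w) = 0" using assms(3,4) by (simp add: euler_lagrange_acc_def)
qed

lemma euler_lagrange_acc_shift:
  assumes xy: "x \<in> S" "y \<noteq> 0" and "euler_lagrange_acc F x y a"
  shows "euler_lagrange_acc F x y (a + k *\<^sub>R y)"
  unfolding euler_lagrange_acc_def
proof
  fix w
  have W: "(x, y) \<in> W" using xy by simp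
  have "(y, a + k *\<^sub>R y) = (y, a) + k *\<^sub>R (0, y)" by simp
  then have "D2 F (x, y) (y, a + k *\<^sub>R y) (0, w) = D2 F (x, y) (y, a) (0, w) + k * D2 F (x, y) (0, y) (0, w)"
    using linear_add[OF linear_D2_left[OF smooth_F W]] linear_scale[OF linear_D2_left[OF smooth_F W]]
    by (metis real_scaleR_def)
  then show "D2 F (x, y) (y, a + k *\<^sub>R y) (0, w) = D1 F (x, y) (w, 0)"
    using assms(3) by (simp add: euler_lagrange_acc_def vertical_hessian_radial[OF xy])
qed

text \<open>The equations of \<open>F\<^sup>2\<close> force \<open>F\<close> to be constant along the curve, which is the vanishing of
  \<open>D1 F (x, y) (y, a)\<close>. For constant \<open>F\<close> the equations of \<open>F\<^sup>2\<close> are those of \<open>F\<close> multiplied by \<open>2 F\<close>.\<close>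

lemma euler_lagrange_acc_of_energy:
  assumes xy: "x \<in> S" "y \<noteq> 0" and E: "euler_lagrange_acc E x y a"
  shows "euler_lagrange_acc F x y a"
  unfolding euler_lagrange_acc_def
proof
  fix w
  have W: "(x, y) \<in> W" using xy by simp
  have Fp: "F (x, y) > 0" by (rule F_pos[OF xy])
  have eq: "D1 F (x, y) (y, a) * D1 F (x, y) (0, w) + F (x, y) * D2 F (x, y) (y, a) (0, w) =
      F (x, y) * D1 F (x, y) (w, 0)" for w
    using E[unfolded euler_lagrange_acc_def, rule_format, of w] unfolding D2_E[OF W] D1_E[OF W]
    by (metis mult_cancel_left zero_neq_numeral)
  \<comment> \<open>For \<open>w = y\<close> Euler's identities turn the equation into the conservation law.\<close>
  have "D1 F (x, y) (y, a) * F (x, y) = 0"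
    using eq[of y] unfolding euler[OF xy] euler_deriv[OF xy] by (simp add: algebra_simps)
  then have "D1 F (x, y) (y, a) = 0" using Fp by simp
  then show "D2 F (x, y) (y, a) (0, w) = D1 F (x, y) (w, 0)" using eq[of w] Fp by simp
qed

text \<open>The Euler-Lagrange equations of \<open>F\<^sup>2\<close> at \<open>z = (x, y)\<close> read
  \<open>energy_hessian (z, a) = energy_source z\<close>.\<close>

definition energy_hessian :: "('a \<times> 'a) \<times> 'a \<Rightarrow> 'a" where
  "energy_hessian p = (\<Sum>b\<in>Basis. D2 E (fst p) (0, snd p) (0, b) *\<^sub>R b)"

definition energy_source :: "'a \<times> 'a \<Rightarrow> 'a" where
  "energy_source z = (\<Sum>b\<in>Basis. (D1 E z (b, 0) - D2 E z (snd z, 0) (0, b)) *\<^sub>R b)"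

lemma smooth_D2_E:
  assumes "open U" "smooth_on U g" "\<And>p. p \<in> U \<Longrightarrow> g p \<in> W" "smooth_on U h"
  shows "smooth_on U (\<lambda>p. D2 E (g p) (h p) w)"
  using smooth_on_compose[OF assms(1) smooth_on_Pair[OF assms(1,2,4)]
      smooth_on_tangent_map[OF smooth_on_D1[OF smooth_E, of w] open_W]] assms(3) by simp

lemma smooth_energy_hessian: "smooth_on (W \<times> UNIV) energy_hessian"
proof -
  have o: "open (W \<times> (UNIV :: 'a set))" by (intro open_Times open_W open_UNIV)
  have "smooth_on (W \<times> UNIV) (\<lambda>p. D2 E (fst p) (0, snd p) (0, b))" for b
    by (intro smooth_D2_E smooth_on_Pair smooth_on_const smooth_on_fst smooth_on_snd o) auto
  then show ?thesis
    unfolding energy_hessian_def by (intro smooth_on_sum smooth_on_scaleR smooth_on_const o finite_Basis)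
qed

lemma smooth_energy_source: "smooth_on W energy_source"
proof -
  have "smooth_on W (\<lambda>z. D2 E z (snd z, 0) (0, b))" for b
    by (intro smooth_D2_E smooth_on_Pair smooth_on_const smooth_on_ident smooth_on_snd open_W) auto
  then show ?thesis
    unfolding energy_source_def
    by (intro smooth_on_sum smooth_on_scaleR smooth_on_const smooth_on_diff smooth_on_D1 smooth_E
        open_W finite_Basis)
qed

lemma energy_hessian_inner:
  assumes "z \<in> W"
  shows "energy_hessian (z, \<xi>) \<bullet> w = D2 E z (0, \<xi>) (0, w)"
proof -
  have "linear (\<lambda>w. D2 E z (0, \<xi>) (0, w))"
    by (rule linear_vertical[OF linear_D2_right[OF smooth_E open_W assms]])
  from inner_sum_Basis_linear[OF this] show ?thesis by (simp add: energy_hessian_def)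
qed

lemma energy_source_inner:
  assumes "z \<in> W"
  shows "energy_source z \<bullet> w = D1 E z (w, 0) - D2 E z (snd z, 0) (0, w)"
proof -
  have "linear (\<lambda>w. D1 E z (w, 0) - D2 E z (snd z, 0) (0, w))"
    by (rule linear_compose_sub[OF linear_horizontal[OF linear_D1[OF smooth_E assms]]
          linear_vertical[OF linear_D2_right[OF smooth_E open_W assms]]])
  from inner_sum_Basis_linear[OF this] show ?thesis by (simp add: energy_source_def)
qed

lemma linear_energy_hessian:
  assumes "z \<in> W"
  shows "linear (\<lambda>\<xi>. energy_hessian (z, \<xi>))"
proof (rule linearI; rule euclidean_eqI)
  note lin = linear_vertical[OF linear_D2_left[OF smooth_E assms]]
  show "energy_hessian (z, \<xi> + \<eta>) \<bullet> w = (energy_hessian (z, \<xi>) + energy_hessian (z, \<eta>)) \<bullet> w" for \<xi> \<eta> w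
    using linear_add[OF lin] by (simp add: inner_left_distrib energy_hessian_inner[OF assms])
  show "energy_hessian (z, k *\<^sub>R \<xi>) \<bullet> w = (k *\<^sub>R energy_hessian (z, \<xi>)) \<bullet> w" for k \<xi> w
    using linear_scale[OF lin] by (simp add: energy_hessian_inner[OF assms])
qed

lemma energy_hessian_pos: "z \<in> W \<Longrightarrow> \<xi> \<noteq> 0 \<Longrightarrow> energy_hessian (z, \<xi>) \<bullet> \<xi> > 0"
  by (auto simp: energy_hessian_inner pos_def)

lemma energy_hessian_solvable:
  assumes "z \<in> W"
  shows "\<exists>a. energy_hessian (z, a) = r"
proof -
  have "inj (\<lambda>\<xi>. energy_hessian (z, \<xi>))"
    unfolding linear_injective_0[OF linear_energy_hessian[OF assms]] using energy_hessian_pos[OF assms] by force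
  then have "surj (\<lambda>\<xi>. energy_hessian (z, \<xi>))" using linear_injective_imp_surjective[OF linear_energy_hessian[OF assms]] by simp
  then show ?thesis by (metis surjD)
qed

lemma euler_lagrange_acc_of_solution:
  assumes z: "(x, y) \<in> W" and a: "energy_hessian ((x, y), a) = energy_source (x, y)"
  shows "euler_lagrange_acc F x y a"
proof (rule euler_lagrange_acc_of_energy)
  show "euler_lagrange_acc E x y a"
    unfolding euler_lagrange_acc_def
  proof
    fix w
    have "D2 E (x, y) (y, a) (0, w) = D2 E (x, y) (y, 0) (0, w) + D2 E (x, y) (0, a) (0, w)"
      using linear_add[OF linear_D2_left[OF smooth_E z], of _ "(y, 0)" "(0, a)"] by simp
    also have "D2 E (x, y) (0, a) (0, w) = D1 E (x, y) (w, 0) - D2 E (x, y) (y, 0) (0, w)"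
      using a energy_hessian_inner[OF z, of a w] energy_source_inner[OF z, of w] by simp
    finally show "D2 E (x, y) (y, a) (0, w) = D1 E (x, y) (w, 0)" by simp
  qed
qed (use z in auto)

lemma lipschitz_spray:
  assumes K: "compact K" "convex K" "K \<subseteq> W"
  shows "\<exists>a C. C-lipschitz_on K a \<and> (\<forall>z\<in>K. euler_lagrange_acc F (fst z) (snd z) (a z))"
proof -
  have "\<exists>a. \<forall>z\<in>K. energy_hessian (z, a z) = energy_source z" by (intro bchoice ballI energy_hessian_solvable) (use K in auto)
  then obtain a where a: "\<And>z. z \<in> K \<Longrightarrow> energy_hessian (z, a z) = energy_source z" by blast
  have "\<exists>C. C-lipschitz_on K a"
    by (rule lipschitz_solution_of_positive_definite_system[OF smooth_energy_hessian _ _ smooth_energy_source a K])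
       (use K in \<open>auto intro!: linear_energy_hessian energy_hessian_pos\<close>)
  moreover have "euler_lagrange_acc F (fst z) (snd z) (a z)" if "z \<in> K" for z
    using euler_lagrange_acc_of_solution[of "fst z" "snd z" "a z"] a[OF that] K that by auto
  ultimately show ?thesis by blast
qed

text \<open>Solve the first order system \<open>\<gamma>' = \<eta>\<close>, \<open>\<eta>' = a(\<gamma>, \<eta>)\<close> in a ball of positions and nonzero velocities.\<close>

lemma geodesic_exists:
  assumes "x \<in> S" "y \<noteq> 0"
  shows "\<exists>\<epsilon>>0. \<exists>\<gamma> \<eta> \<alpha>. \<gamma> 0 = x \<and> \<eta> 0 = y \<and> continuous_on {-\<epsilon><..<\<epsilon>} \<alpha> \<and>
    (\<forall>t\<in>{-\<epsilon><..<\<epsilon>}. \<gamma> t \<in> S \<and> \<eta> t \<noteq> 0 \<and> (\<gamma> has_vector_derivative \<eta> t) (at t) \<and>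
      (\<eta> has_vector_derivative \<alpha> t) (at t) \<and> euler_lagrange_acc F (\<gamma> t) (\<eta> t) (\<alpha> t))"
proof -
  have "(x, y) \<in> W" using assms by simp
  then obtain r where r: "r > 0" "cball (x, y) r \<subseteq> W" using open_W open_contains_cball by blast
  obtain a C where a: "C-lipschitz_on (cball (x, y) r) a"
      "\<And>z. z \<in> cball (x, y) r \<Longrightarrow> euler_lagrange_acc F (fst z) (snd z) (a z)"
    using lipschitz_spray[OF compact_cball convex_cball r(2)] by blast
  have "1-lipschitz_on (cball (x, y) r) (snd :: 'a \<times> 'a \<Rightarrow> 'a)"
    by (rule lipschitz_onI) (auto simp: dist_snd_le)
  from picard_lindelof[OF r(1) lipschitz_on_Pair[OF this a(1)]]
  obtain \<epsilon> z where e: "\<epsilon> > 0" and z0: "z 0 = (x, y)" and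
    z: "\<And>t. t \<in> {-\<epsilon><..<\<epsilon>} \<Longrightarrow> z t \<in> cball (x, y) r"
      "\<And>t. t \<in> {-\<epsilon><..<\<epsilon>} \<Longrightarrow> (z has_vector_derivative (snd (z t), a (z t))) (at t)" by blast
  have "continuous_on {-\<epsilon><..<\<epsilon>} z"
    using z(2) by (intro continuous_at_imp_continuous_on ballI) (rule has_vector_derivative_continuous)
  then have ca: "continuous_on {-\<epsilon><..<\<epsilon>} (\<lambda>t. a (z t))"
    by (rule continuous_on_compose2[OF lipschitz_on_continuous_on[OF a(1)]]) (use z(1) in auto)
  have "z t \<in> W \<and> ((\<lambda>t. fst (z t)) has_vector_derivative snd (z t)) (at t) \<and>
      ((\<lambda>t. snd (z t)) has_vector_derivative a (z t)) (at t) \<and>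
      euler_lagrange_acc F (fst (z t)) (snd (z t)) (a (z t))" if t: "t \<in> {-\<epsilon><..<\<epsilon>}" for t
    using bounded_linear.has_vector_derivative[OF bounded_linear_fst z(2)[OF t]]
      bounded_linear.has_vector_derivative[OF bounded_linear_snd z(2)[OF t]]
      a(2)[OF z(1)[OF t]] z(1)[OF t] r(2) by auto
  then show ?thesis
    by (intro exI[of _ \<epsilon>] conjI e exI[of _ "\<lambda>t. fst (z t)"] exI[of _ "\<lambda>t. snd (z t)"]
        exI[of _ "\<lambda>t. a (z t)"] ca ballI) (auto simp: z0 mem_Times_iff)
qed

end

section \<open>Pullback along immersions\<close>

definition tangent_map :: "('b::euclidean_space \<Rightarrow> 'a::euclidean_space) \<Rightarrow> 'b \<times> 'b \<Rightarrow> 'a \<times> 'a" where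
  "tangent_map \<phi> p = (\<phi> (fst p), D1 \<phi> (fst p) (snd p))"

text \<open>The open set \<open>S\<close> is part of the data because Finsler functions on \<open>S\<close> are pulled back to \<open>U\<close>.\<close>

locale immersion =
  fixes U :: "'b::euclidean_space set" and \<phi> :: "'b \<Rightarrow> 'a::euclidean_space" and S :: "'a set"
  assumes open_U: "open U" and open_S: "open S" and smooth_phi: "smooth_on U \<phi>"
    and phi_in: "u \<in> U \<Longrightarrow> \<phi> u \<in> S"
    and inj: "\<lbrakk>u \<in> U; v \<noteq> 0\<rbrakk> \<Longrightarrow> D1 \<phi> u v \<noteq> 0"
begin

abbreviation "\<Phi> \<equiv> tangent_map \<phi>"
abbreviation "V \<equiv> U \<times> {v::'b. v \<noteq> 0}"
abbreviation "W \<equiv> S \<times> {y::'a. y \<noteq> 0}"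

lemma open_V: "open V"
  by (rule open_Times_nonzero[OF open_U])

lemma open_W: "open W"
  by (rule open_Times_nonzero[OF open_S])

lemma Phi_in: "p \<in> V \<Longrightarrow> \<Phi> p \<in> W"
  by (auto simp: tangent_map_def phi_in inj)

lemma smooth_Phi: "smooth_on V \<Phi>"
  unfolding tangent_map_def
proof (rule smooth_on_Pair[OF open_V])
  show "smooth_on V (\<lambda>p. \<phi> (fst p))"
    by (rule smooth_on_compose[OF open_V smooth_on_fst[OF open_V] smooth_phi]) auto
  show "smooth_on V (\<lambda>p. D1 \<phi> (fst p) (snd p))"
    by (rule smooth_on_subset[OF smooth_on_tangent_map[OF smooth_phi open_U]]) auto
qed

lemma Phi_has_derivative:
  assumes "p \<in> V"
  shows "(\<Phi> has_derivative (\<lambda>(a, b). (D1 \<phi> (fst p) a, D2 \<phi> (fst p) a (snd p) + D1 \<phi> (fst p) b))) (at p)"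
proof -
  have p: "fst p \<in> U" using assms by auto
  have f: "(fst has_derivative fst) (at p)" and s: "(snd has_derivative snd) (at p)"
    by (auto intro: bounded_linear_imp_has_derivative bounded_linear_fst bounded_linear_snd)
  show ?thesis
    unfolding tangent_map_def case_prod_unfold
    by (rule has_derivative_Pair)
       (use diff_chain_at[OF f smooth_on_has_derivative[OF smooth_phi p]]
         D1_moving[OF smooth_phi open_U f p s] in \<open>simp_all add: o_def\<close>)
qed

lemma D1_pullback:
  assumes H: "smooth_on W H" and p: "p \<in> V"
  shows "D1 (\<lambda>p. H (\<Phi> p)) p (a, b) =
    D1 H (\<Phi> p) (D1 \<phi> (fst p) a, D2 \<phi> (fst p) a (snd p) + D1 \<phi> (fst p) b)"
  using D1_eqI[OF diff_chain_at[OF Phi_has_derivative[OF p] smooth_on_has_derivative[OF H Phi_in[OF p]]], of "(a, b)"]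
  by (simp add: o_def)

lemma D1_pullback_vertical:
  assumes H: "smooth_on W H" and p: "p \<in> V"
  shows "D1 (\<lambda>p. H (\<Phi> p)) p (0, w) = D1 H (\<Phi> p) (0, D1 \<phi> (fst p) w)"
proof -
  have "fst p \<in> U" using p by auto
  then show ?thesis
    unfolding D1_pullback[OF assms]
    by (simp add: linear_0[OF linear_D1[OF smooth_phi]] linear_0[OF linear_D2_left[OF smooth_phi]])
qed

lemma D2_pullback:
  assumes H: "smooth_on W H" and p: "p \<in> V"
  shows "D2 (\<lambda>p. H (\<Phi> p)) p (a, b) (0, w) =
    D2 H (\<Phi> p) (D1 \<phi> (fst p) a, D2 \<phi> (fst p) a (snd p) + D1 \<phi> (fst p) b) (0, D1 \<phi> (fst p) w) +
    D1 H (\<Phi> p) (0, D2 \<phi> (fst p) a w)"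
proof -
  have pU: "fst p \<in> U" using p by auto
  have f: "(fst has_derivative fst) (at p)"
    by (auto intro: bounded_linear_imp_has_derivative bounded_linear_fst)
  have "((\<lambda>p. D1 \<phi> (fst p) w) has_derivative (\<lambda>q. D2 \<phi> (fst p) (fst q) w)) (at p)"
    using diff_chain_at[OF f smooth_on_has_derivative[OF smooth_on_D1[OF smooth_phi] pU]]
    by (simp add: o_def)
  then have "((\<lambda>p. (0::'a, D1 \<phi> (fst p) w)) has_derivative (\<lambda>q. (0, D2 \<phi> (fst p) (fst q) w))) (at p)"
    by (rule has_derivative_Pair[OF has_derivative_const])
  from D1_moving[OF H open_W Phi_has_derivative[OF p] Phi_in[OF p] this]
  have "((\<lambda>p. D1 (\<lambda>p. H (\<Phi> p)) p (0, w)) has_derivative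
    (\<lambda>q. D2 H (\<Phi> p) (case q of (a, b) \<Rightarrow> (D1 \<phi> (fst p) a, D2 \<phi> (fst p) a (snd p) + D1 \<phi> (fst p) b))
        (0, D1 \<phi> (fst p) w) + D1 H (\<Phi> p) (0, D2 \<phi> (fst p) (fst q) w))) (at p)"
    by (rule has_derivative_transform_within_open[OF _ open_V p]) (simp only: D1_pullback_vertical[OF H])
  from D1_eqI[OF this, of "(a, b)"] show ?thesis by simp
qed

text \<open>The acceleration of \<open>\<phi> \<circ> u\<close> is \<open>D2 \<phi> u v v + D1 \<phi> u a\<close> if \<open>u\<close> has velocity \<open>v\<close> and acceleration \<open>a\<close>.
  Pulled back, each side of the equation acquires a term with the second derivative of \<open>\<phi>\<close> in the
  directions \<open>v\<close> and \<open>w\<close>; these terms cancel because that derivative is symmetric.\<close>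

lemma euler_lagrange_acc_pullback:
  assumes F: "smooth_on W F" and u: "u \<in> U" "v \<noteq> 0"
    and EL: "euler_lagrange_acc F (\<phi> u) (D1 \<phi> u v) (D2 \<phi> u v v + D1 \<phi> u a)"
  shows "euler_lagrange_acc (\<lambda>p. F (\<Phi> p)) u v a"
  unfolding euler_lagrange_acc_def
proof
  fix w
  have p: "(u, v) \<in> V" using u by simp
  have lin: "linear (D1 F (\<Phi> (u, v)))" by (rule linear_D1[OF F Phi_in[OF p]])
  have "D2 (\<lambda>p. F (\<Phi> p)) (u, v) (v, a) (0, w) =
    D2 F (\<Phi> (u, v)) (D1 \<phi> u v, D2 \<phi> u v v + D1 \<phi> u a) (0, D1 \<phi> u w) + D1 F (\<Phi> (u, v)) (0, D2 \<phi> u v w)"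
    by (simp add: D2_pullback[OF F p])
  also have "\<dots> = D1 F (\<Phi> (u, v)) (D1 \<phi> u w, 0) + D1 F (\<Phi> (u, v)) (0, D2 \<phi> u v w)"
    using EL by (simp add: euler_lagrange_acc_def tangent_map_def)
  also have "\<dots> = D1 F (\<Phi> (u, v)) (D1 \<phi> u w, D2 \<phi> u v w)"
    using linear_add[OF lin, of "(D1 \<phi> u w, 0)" "(0, D2 \<phi> u v w)"] by simp
  also have "\<dots> = D1 F (\<Phi> (u, v)) (D1 \<phi> u w, D2 \<phi> u w v)"
    by (simp only: D2_sym[OF smooth_phi open_U u(1), where v = v and w = w])
  also have "\<dots> = D1 (\<lambda>p. F (\<Phi> p)) (u, v) (w, 0)"
    by (simp add: D1_pullback[OF F p] linear_0[OF linear_D1[OF smooth_phi u(1)]])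
  finally show "D2 (\<lambda>p. F (\<Phi> p)) (u, v) (v, a) (0, w) = D1 (\<lambda>p. F (\<Phi> p)) (u, v) (w, 0)" .
qed

text \<open>On vertical vectors the second derivative of \<open>\<phi>\<close> does not contribute, so the fundamental
  tensor pulls back like a bilinear form and stays positive definite by injectivity.\<close>

lemma local_finsler_pullback:
  assumes "local_finsler S F"
  shows "local_finsler U (\<lambda>p. F (\<Phi> p))"
proof
  interpret F: local_finsler S F by fact
  show "open U" by (rule open_U)
  show "smooth_on V (\<lambda>p. F (\<Phi> p))"
    by (rule smooth_on_compose[OF open_V smooth_Phi F.smooth_F Phi_in])
  fix u v assume u: "u \<in> U" "v \<noteq> (0::'b)"
  have p: "(u, v) \<in> V" using u by simp
  show "F (\<Phi> (u, k *\<^sub>R v)) = k * F (\<Phi> (u, v))" if "k > 0" for k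
    using F.homogeneous[OF phi_in[OF u(1)] inj[OF u] that] linear_scale[OF linear_D1[OF smooth_phi u(1)]]
    by (simp add: tangent_map_def)
  show "F (\<Phi> (u, v)) > 0" using F.F_pos[OF phi_in[OF u(1)] inj[OF u]] by (simp add: tangent_map_def)
  fix \<xi> :: 'b assume xi: "\<xi> \<noteq> 0"
  have "D2 (\<lambda>p. (F (\<Phi> p))\<^sup>2) (u, v) (0, \<xi>) (0, \<xi>) =
      D2 (\<lambda>z. (F z)\<^sup>2) (\<Phi> (u, v)) (0, D1 \<phi> u \<xi>) (0, D1 \<phi> u \<xi>)"
    using linear_0[OF linear_D1[OF F.smooth_E Phi_in[OF p]]]
    by (simp add: D2_pullback[OF F.smooth_E p] linear_0[OF linear_D1[OF smooth_phi u(1)]]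
        linear_0[OF linear_D2_left[OF smooth_phi u(1)]] zero_prod_def)
  then show "D2 (\<lambda>p. (F (\<Phi> p))\<^sup>2) (u, v) (0, \<xi>) (0, \<xi>) > 0"
    using F.pos_def[OF phi_in[OF u(1)] inj[OF u] inj[OF u(1) xi]] by (simp add: tangent_map_def)
qed

end

section \<open>Curves and the Euler-Lagrange equations along them\<close>

abbreviation velocity :: "(real \<Rightarrow> 'a::real_normed_vector) \<Rightarrow> real \<Rightarrow> 'a" where
  "velocity x t \<equiv> vector_derivative x (at t)"

abbreviation acceleration :: "(real \<Rightarrow> 'a::real_normed_vector) \<Rightarrow> real \<Rightarrow> 'a" where
  "acceleration x t \<equiv> velocity (velocity x) t"

lemma velocity_cong:
  assumes "open T" "t \<in> T" "\<And>s. s \<in> T \<Longrightarrow> x s = y s"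
  shows "velocity x t = velocity y t"
  by (rule vector_derivative_cong_eq)
    (use assms in \<open>auto intro: eventually_nhds_in_open eventually_mono\<close>)

lemma C_k_2_velocity:
  fixes x :: "real \<Rightarrow> 'a::euclidean_space"
  assumes "open T" "C_k 2 T x" "t \<in> T"
  shows "(x has_vector_derivative velocity x t) (at t)"
    and "(velocity x has_vector_derivative acceleration x t) (at t)"
proof -
  have 2: "C_k (Suc (Suc 0)) T x" using assms(2) by (simp add: numeral_2_eq_2)
  have v: "(x has_vector_derivative velocity x s) (at s)" if "s \<in> T" for s
    using 2 that by (simp add: vector_derivative_works[symmetric])
  then show "(x has_vector_derivative velocity x t) (at t)" using assms(3) by simp
  have eq: "D1 x s 1 = velocity x s" if "s \<in> T" for s
    using D1_eqI[OF v[OF that, unfolded has_vector_derivative_def], of 1] by simp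
  have "(\<lambda>s. D1 x s 1) differentiable (at t)" using 2 assms(3) by simp
  then obtain f' where "((\<lambda>s. D1 x s 1) has_derivative f') (at t)" by (auto simp: differentiable_def)
  then have "(velocity x has_derivative f') (at t)"
    by (rule has_derivative_transform_within_open[OF _ assms(1,3)]) (simp add: eq)
  then have "velocity x differentiable (at t)" by (auto simp: differentiable_def)
  then show "(velocity x has_vector_derivative acceleration x t) (at t)"
    by (simp add: vector_derivative_works[symmetric])
qed

lemma C_k_2I:
  fixes x :: "real \<Rightarrow> 'a::euclidean_space"
  assumes "open T" "\<And>t. t \<in> T \<Longrightarrow> (x has_vector_derivative y t) (at t)"
    "\<And>t. t \<in> T \<Longrightarrow> (y has_vector_derivative a t) (at t)" "continuous_on T a"
  shows "C_k 2 T x"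
proof -
  have "C_k (Suc 0) T (\<lambda>t. v *\<^sub>R y t)" for v :: real
  proof (rule C_k_SucI[OF assms(1)])
    show "((\<lambda>t. v *\<^sub>R y t) has_derivative (\<lambda>w. v *\<^sub>R (w *\<^sub>R a t))) (at t)" if "t \<in> T" for t
      using has_derivative_scaleR_right[OF assms(3)[OF that, unfolded has_vector_derivative_def]] .
    show "C_k 0 T (\<lambda>t. v *\<^sub>R (w *\<^sub>R a t))" for w
      using assms(4) by (simp add: continuous_on_scaleR)
  qed
  then have "C_k (Suc (Suc 0)) T x"
    using assms(2) unfolding has_vector_derivative_def
    by (intro C_k_SucI[OF assms(1), of x "\<lambda>t v. v *\<^sub>R y t"])
  then show ?thesis by (simp add: numeral_2_eq_2)
qed

definition euler_lagrange_curve :: "('a::euclidean_space \<times> 'a \<Rightarrow> real) \<Rightarrow> (real \<Rightarrow> 'a) \<Rightarrow> real \<Rightarrow> bool" where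
  "euler_lagrange_curve F x t \<longleftrightarrow> euler_lagrange_acc F (x t) (velocity x t) (acceleration x t)"

lemma euler_lagrange_curve_cong:
  assumes "open T" "t \<in> T" "\<And>s. s \<in> T \<Longrightarrow> x s = y s"
  shows "euler_lagrange_curve F x t \<longleftrightarrow> euler_lagrange_curve F y t"
proof -
  have v: "velocity x s = velocity y s" if "s \<in> T" for s
    using velocity_cong[OF assms(1) that assms(3)] .
  have "acceleration x t = acceleration y t" by (rule velocity_cong[OF assms(1,2) v])
  then show ?thesis by (simp add: euler_lagrange_curve_def v assms)
qed

lemma euler_lagrange_acc_cong:
  assumes "open W" "(x, y) \<in> W" "\<And>z. z \<in> W \<Longrightarrow> F z = G z" "smooth_on W F"
  shows "euler_lagrange_acc F x y a \<longleftrightarrow> euler_lagrange_acc G x y a"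
proof -
  have 1: "D1 G z v = D1 F z v" if "z \<in> W" for z v
    by (rule D1_eqI, rule has_derivative_transform_within_open[OF smooth_on_has_derivative[OF assms(4) that] assms(1) that])
      (rule assms(3))
  have 2: "D2 G z v w = D2 F z v w" if "z \<in> W" for z v w
    by (rule D1_eqI, rule has_derivative_transform_within_open[OF
      smooth_on_has_derivative[OF smooth_on_D1[OF assms(4)] that] assms(1) that]) (simp add: 1)
  show ?thesis by (simp add: euler_lagrange_acc_def 1[OF assms(2)] 2[OF assms(2)])
qed

lemma D1_partial_vertical:
  assumes "smooth_on W H" "(x, y) \<in> W"
  shows "frechet_derivative (\<lambda>w. H (x, w)) (at y) v = D1 H (x, y) (0, v)"
proof -
  have "((\<lambda>w. (x, w)) has_derivative (\<lambda>v. (0, v))) (at y)" by (auto intro!: derivative_eq_intros)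
  from D1_eqI[OF diff_chain_at[OF this smooth_on_has_derivative[OF assms]]] show ?thesis
    by (simp add: o_def)
qed

lemma D1_partial_horizontal:
  assumes "smooth_on W H" "(x, y) \<in> W"
  shows "frechet_derivative (\<lambda>w. H (w, y)) (at x) v = D1 H (x, y) (v, 0)"
proof -
  have "((\<lambda>w. (w, y)) has_derivative (\<lambda>v. (v, 0))) (at x)" by (auto intro!: derivative_eq_intros)
  from D1_eqI[OF diff_chain_at[OF this smooth_on_has_derivative[OF assms]]] show ?thesis
    by (simp add: o_def)
qed

lemma linear_eq_sum_axis:
  fixes h :: "real^'n::finite \<Rightarrow> real"
  assumes "linear h"
  shows "h \<xi> = (\<Sum>i\<in>UNIV. \<xi> $ i * h (axis i 1))"
proof -
  have "h \<xi> = h (\<Sum>i\<in>UNIV. (\<xi> $ i) *\<^sub>R axis i 1)"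
    using basis_expansion[of \<xi>] by (simp add: scalar_mult_eq_scaleR)
  then show ?thesis by (simp add: linear_sum[OF assms] linear_scale[OF assms])
qed

text \<open>Along a curve of class \<open>C\<^sup>2\<close> the time derivative in the Euler-Lagrange equations exists by the chain
  rule, so they are an algebraic condition on position, velocity and acceleration.\<close>

lemma euler_lagrange_at_iff:
  fixes F :: "real^'n::finite \<Rightarrow> real^'n \<Rightarrow> real"
  assumes S: "open S" "smooth_on (S \<times> {y. y \<noteq> 0}) (case_prod F)"
    and T: "open T" "t \<in> T" "C_k 2 T x"
    and x: "\<And>s. s \<in> T \<Longrightarrow> x s \<in> S" "\<And>s. s \<in> T \<Longrightarrow> velocity x s \<noteq> 0"
  shows "euler_lagrange_at F x t \<longleftrightarrow> euler_lagrange_curve (case_prod F) x t"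
proof -
  let ?F = "case_prod F" and ?y = "velocity x" and ?a = "acceleration x t"
  let ?W = "S \<times> {y::real^'n. y \<noteq> 0}"
  have oW: "open ?W" by (rule open_Times_nonzero[OF S(1)])
  have W: "(x s, ?y s) \<in> ?W" if "s \<in> T" for s using x that by simp
  have v: "partial i (F (x s)) (?y s) = D1 ?F (x s, ?y s) (0, axis i 1)" if "s \<in> T" for i s
    using D1_partial_vertical[OF S(2) W[OF that], of "axis i 1"] by (simp add: partial_def)
  have h: "partial i (\<lambda>z. F z (?y t)) (x t) = D1 ?F (x t, ?y t) (axis i 1, 0)" for i
    using D1_partial_horizontal[OF S(2) W[OF T(2)], of "axis i 1"] by (simp add: partial_def)
  note C = C_k_2_velocity[OF T(1,3,2), unfolded has_vector_derivative_def]
  have lin: "linear (\<lambda>u. D2 ?F (x t, ?y t) u w)" for w by (rule linear_D2_left[OF S(2) W[OF T(2)]])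
  have scale: "D2 ?F (x t, ?y t) (p *\<^sub>R ?y t, p *\<^sub>R ?a) w = p * D2 ?F (x t, ?y t) (?y t, ?a) w" for p w
    using linear_scale[OF lin[of w], of p "(?y t, ?a)"] by simp
  have "((\<lambda>s. D1 ?F (x s, ?y s) (0, axis i 1)) has_derivative
      (\<lambda>p. D2 ?F (x t, ?y t) (p *\<^sub>R ?y t, p *\<^sub>R ?a) (0, axis i 1))) (at t)" for i
    using diff_chain_at[OF has_derivative_Pair[OF C]
        smooth_on_has_derivative[OF smooth_on_D1[OF S(2)] W[OF T(2)]]] by (simp add: o_def)
  then have "((\<lambda>s. D1 ?F (x s, ?y s) (0, axis i 1)) has_real_derivative
      D2 ?F (x t, ?y t) (?y t, ?a) (0, axis i 1)) (at t)" for i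
    by (simp add: has_field_derivative_def scale mult_commute_abs)
  then have d: "((\<lambda>s. partial i (F (x s)) (?y s)) has_real_derivative
      D2 ?F (x t, ?y t) (?y t, ?a) (0, axis i 1)) (at t)" for i
    by (rule has_field_derivative_transform_within_open[OF _ T(1,2)]) (simp add: v)
  have "((\<lambda>s. partial i (F (x s)) (?y s)) has_real_derivative b) (at t) \<longleftrightarrow>
      D2 ?F (x t, ?y t) (?y t, ?a) (0, axis i 1) = b" for i b
    using d[of i] DERIV_unique[OF d[of i], of b] by auto
  then have "euler_lagrange_at F x t \<longleftrightarrow>
      (\<forall>i. D2 ?F (x t, ?y t) (?y t, ?a) (0, axis i 1) = D1 ?F (x t, ?y t) (axis i 1, 0))"
    unfolding euler_lagrange_at_def Let_def h by simp
  also have "\<dots> \<longleftrightarrow> euler_lagrange_curve ?F x t"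
  proof
    assume *: "\<forall>i. D2 ?F (x t, ?y t) (?y t, ?a) (0, axis i 1) = D1 ?F (x t, ?y t) (axis i 1, 0)"
    show "euler_lagrange_curve ?F x t"
      unfolding euler_lagrange_curve_def euler_lagrange_acc_def
    proof
      fix w
      have l: "linear (\<lambda>w. D2 ?F (x t, ?y t) (?y t, ?a) (0, w))"
        by (rule linear_vertical[OF linear_D2_right[OF S(2) oW W[OF T(2)]]])
      have r: "linear (\<lambda>w. D1 ?F (x t, ?y t) (w, 0))"
        by (rule linear_horizontal[OF linear_D1[OF S(2) W[OF T(2)]]])
      show "D2 ?F (x t, ?y t) (?y t, ?a) (0, w) = D1 ?F (x t, ?y t) (w, 0)"
        unfolding linear_eq_sum_axis[OF l, of w] linear_eq_sum_axis[OF r, of w] by (simp only: *)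
    qed
  qed (simp add: euler_lagrange_curve_def euler_lagrange_acc_def)
  finally show ?thesis .
qed

text \<open>The partial derivatives in the fundamental tensor fix the base point; they are therefore
  derivatives in vertical directions on the product.\<close>

lemma finsler_imp_local_finsler:
  fixes A :: "('p::topological_space, 'n::finite) chart set"
  assumes L: "finsler A L" and c: "c \<in> A" "is_chart c"
  shows "local_finsler (cod_of c) (case_prod (local_rep A L c))"
proof
  let ?F = "local_rep A L c" and ?W = "cod_of c \<times> {y::real^'n. y \<noteq> 0}"
  let ?E = "\<lambda>z. (case_prod ?F z)\<^sup>2"
  note fin = bspec[OF L[unfolded finsler_def] c(1)]
  show o: "open (cod_of c)" by (rule chart_facts(5)[OF c(2)])
  then have oW: "open ?W" by (rule open_Times_nonzero)
  show sm: "smooth_on ?W (case_prod ?F)" using conjunct1[OF fin] .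
  have sE: "smooth_on ?W ?E" unfolding power2_eq_square by (intro smooth_on_mult oW sm)
  fix x y assume x: "x \<in> cod_of c" and y: "y \<noteq> (0::real^'n)"
  note fin_x = bspec[OF conjunct2[OF fin] x]
  show "case_prod ?F (x, k *\<^sub>R y) = k * case_prod ?F (x, y)" if "k > 0" for k
    using fin_x that by simp
  show "case_prod ?F (x, y) > 0" using fin_x y by simp
  have W: "(x, z) \<in> ?W \<longleftrightarrow> z \<noteq> 0" for z using x by simp
  have g: "fundamental_tensor ?F x y i j = 1/2 * D2 ?E (x, y) (0, axis i 1) (0, axis j 1)" for i j
  proof -
    have j: "partial j (\<lambda>w. (?F x w)\<^sup>2) z = D1 ?E (x, z) (0, axis j 1)" if "z \<noteq> 0" for z
      using D1_partial_vertical[OF sE, of x z "axis j 1"] that x by (simp add: partial_def)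
    have "((\<lambda>w. (x, w)) has_derivative (\<lambda>v. (0, v))) (at y)" by (auto intro!: derivative_eq_intros)
    from diff_chain_at[OF this smooth_on_has_derivative[OF smooth_on_D1[OF sE] iffD2[OF W y]]]
    have "((\<lambda>z. D1 ?E (x, z) (0, axis j 1)) has_derivative
        (\<lambda>v. D2 ?E (x, y) (0, v) (0, axis j 1))) (at y)" by (simp add: o_def)
    then have "((\<lambda>z. partial j (\<lambda>w. (?F x w)\<^sup>2) z) has_derivative
        (\<lambda>v. D2 ?E (x, y) (0, v) (0, axis j 1))) (at y)"
      by (rule has_derivative_transform_within_open[of _ _ _ _ "- {0}"]) (use y in \<open>auto simp: j open_Compl\<close>)
    from D1_eqI[OF this] show ?thesis by (simp add: fundamental_tensor_def partial_def[of i])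
  qed
  fix \<xi> :: "real^'n" assume xi: "\<xi> \<noteq> 0"
  have "D2 ?E (x, y) (0, \<xi>) (0, \<xi>) = (\<Sum>i\<in>UNIV. \<xi> $ i * D2 ?E (x, y) (0, axis i 1) (0, \<xi>))"
    by (rule linear_eq_sum_axis[OF linear_vertical[OF linear_D2_left[OF sE iffD2[OF W y]]]])
  also have "\<dots> = (\<Sum>i\<in>UNIV. \<xi> $ i * (\<Sum>j\<in>UNIV. \<xi> $ j * D2 ?E (x, y) (0, axis i 1) (0, axis j 1)))"
    by (intro sum.cong refl arg_cong2[where f = times]
        linear_eq_sum_axis[OF linear_vertical[OF linear_D2_right[OF sE oW iffD2[OF W y]]]])
  also have "\<dots> = 2 * (\<Sum>i\<in>UNIV. \<Sum>j\<in>UNIV. fundamental_tensor ?F x y i j * \<xi> $ i * \<xi> $ j)"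
    by (simp add: g sum_distrib_left mult_ac)
  finally have "D2 ?E (x, y) (0, \<xi>) (0, \<xi>) =
    2 * (\<Sum>i\<in>UNIV. \<Sum>j\<in>UNIV. fundamental_tensor ?F x y i j * \<xi> $ i * \<xi> $ j)" .
  moreover have "(\<Sum>i\<in>UNIV. \<Sum>j\<in>UNIV. fundamental_tensor ?F x y i j * \<xi> $ i * \<xi> $ j) > 0"
    using fin_x y xi by simp
  ultimately show "D2 ?E (x, y) (0, \<xi>) (0, \<xi>) > 0" by simp
qed

context immersion
begin

lemma curve_C_k_2:
  assumes T: "open T" "C_k 2 T u" and u: "\<And>s. s \<in> T \<Longrightarrow> u s \<in> U"
  shows "C_k 2 T (\<lambda>s. \<phi> (u s))"
  using C_k_compose[OF T(1) _ T(2) smooth_on_C_k[OF smooth_phi]] u by (auto simp: o_def)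

lemma curve_velocity:
  assumes T: "open T" "C_k 2 T u" and u: "\<And>s. s \<in> T \<Longrightarrow> u s \<in> U" and t: "t \<in> T"
  shows "velocity (\<lambda>s. \<phi> (u s)) t = D1 \<phi> (u t) (velocity u t)"
proof (rule vector_derivative_at)
  show "((\<lambda>s. \<phi> (u s)) has_vector_derivative D1 \<phi> (u t) (velocity u t)) (at t)"
    using diff_chain_at[OF C_k_2_velocity(1)[OF T t, unfolded has_vector_derivative_def]
        smooth_on_has_derivative[OF smooth_phi u[OF t]]]
    by (simp add: has_vector_derivative_def o_def linear_scale[OF linear_D1[OF smooth_phi u[OF t]]])
qed

lemma curve_velocity_nonzero:
  assumes T: "open T" "C_k 2 T u" and u: "\<And>s. s \<in> T \<Longrightarrow> u s \<in> U" and t: "t \<in> T" "velocity u t \<noteq> 0"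
  shows "velocity (\<lambda>s. \<phi> (u s)) t \<noteq> 0"
  using curve_velocity[OF T u t(1)] inj[OF u[OF t(1)] t(2)] by simp

lemma curve_acceleration:
  assumes T: "open T" "C_k 2 T u" and u: "\<And>s. s \<in> T \<Longrightarrow> u s \<in> U" and t: "t \<in> T"
  shows "acceleration (\<lambda>s. \<phi> (u s)) t =
    D2 \<phi> (u t) (velocity u t) (velocity u t) + D1 \<phi> (u t) (acceleration u t)"
proof (rule vector_derivative_at)
  note C = C_k_2_velocity[OF T t, unfolded has_vector_derivative_def]
  have "((\<lambda>s. D1 \<phi> (u s) (velocity u s)) has_vector_derivative
      D2 \<phi> (u t) (velocity u t) (velocity u t) + D1 \<phi> (u t) (acceleration u t)) (at t)"
    using D1_moving[OF smooth_phi open_U C(1) u[OF t] C(2)]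
    by (simp add: has_vector_derivative_def linear_scale[OF linear_D1[OF smooth_phi u[OF t]]]
        linear_scale[OF linear_D2_left[OF smooth_phi u[OF t]]] scaleR_add_right)
  then show "(velocity (\<lambda>s. \<phi> (u s)) has_vector_derivative
      D2 \<phi> (u t) (velocity u t) (velocity u t) + D1 \<phi> (u t) (acceleration u t)) (at t)"
    by (rule has_vector_derivative_transform_within_open[OF _ T(1) t])
      (simp add: curve_velocity[OF T u])
qed

lemma euler_lagrange_curve_pullback:
  assumes F: "smooth_on W F"
    and T: "open T" "C_k 2 T u" and u: "\<And>s. s \<in> T \<Longrightarrow> u s \<in> U" and t: "t \<in> T" "velocity u t \<noteq> 0"
    and EL: "euler_lagrange_curve F (\<lambda>s. \<phi> (u s)) t"
  shows "euler_lagrange_curve (\<lambda>p. F (\<Phi> p)) u t"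
  unfolding euler_lagrange_curve_def
  by (rule euler_lagrange_acc_pullback[OF F u[OF t(1)] t(2)])
    (use EL in \<open>simp add: euler_lagrange_curve_def curve_velocity[OF T u t(1)] curve_acceleration[OF T u t(1)]\<close>)

text \<open>The curve \<open>u\<close> satisfies only the pulled back equations; the curve \<open>w\<close>, tangent to it, has an image
  that satisfies the equations of \<open>F\<close> itself. By uniqueness downstairs the accelerations of \<open>u\<close> and
  \<open>w\<close> differ by a multiple of the common velocity, hence so do those of the images, and such a
  difference does not affect the equations of \<open>F\<close>.\<close>

lemma euler_lagrange_curve_pushforward:
  assumes "local_finsler S F"
    and T: "open T" "C_k 2 T u" and u: "\<And>s. s \<in> T \<Longrightarrow> u s \<in> U" and t: "t \<in> T" "velocity u t \<noteq> 0"
    and EL: "euler_lagrange_curve (\<lambda>p. F (\<Phi> p)) u t"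
    and R: "open R" "C_k 2 R w" and w: "\<And>s. s \<in> R \<Longrightarrow> w s \<in> U" and r: "r \<in> R"
    and wu: "w r = u t" "velocity w r = velocity u t"
    and ELw: "euler_lagrange_curve F (\<lambda>s. \<phi> (w s)) r"
  shows "euler_lagrange_curve F (\<lambda>s. \<phi> (u s)) t"
proof -
  interpret F: local_finsler S F by fact
  interpret P: local_finsler U "\<lambda>p. F (\<Phi> p)" by (rule local_finsler_pullback) fact
  have r0: "velocity w r \<noteq> 0" using t(2) wu(2) by simp
  have "euler_lagrange_curve (\<lambda>p. F (\<Phi> p)) w r"
    by (rule euler_lagrange_curve_pullback[OF F.smooth_F R w r r0 ELw])
  then have "euler_lagrange_acc (\<lambda>p. F (\<Phi> p)) (u t) (velocity u t) (acceleration w r)"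
    by (simp add: euler_lagrange_curve_def wu)
  with EL obtain k where k: "acceleration u t - acceleration w r = k *\<^sub>R velocity u t"
    using P.euler_lagrange_acc_unique[OF u[OF t(1)] t(2)] unfolding euler_lagrange_curve_def by blast
  have acc: "acceleration (\<lambda>s. \<phi> (u s)) t =
      acceleration (\<lambda>s. \<phi> (w s)) r + k *\<^sub>R velocity (\<lambda>s. \<phi> (u s)) t"
  proof -
    have "acceleration u t = acceleration w r + k *\<^sub>R velocity u t" using k by (simp add: algebra_simps)
    then have "D1 \<phi> (u t) (acceleration u t) =
        D1 \<phi> (u t) (acceleration w r) + k *\<^sub>R D1 \<phi> (u t) (velocity u t)"
      by (simp only: linear_add[OF linear_D1[OF smooth_phi u[OF t(1)]]]
          linear_scale[OF linear_D1[OF smooth_phi u[OF t(1)]]])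
    then show ?thesis
      by (simp add: curve_acceleration[OF T u t(1)] curve_acceleration[OF R w r] wu
          curve_velocity[OF T u t(1)])
  qed
  have "velocity (\<lambda>s. \<phi> (w s)) r = velocity (\<lambda>s. \<phi> (u s)) t"
    by (simp add: curve_velocity[OF T u t(1)] curve_velocity[OF R w r] wu)
  then have "euler_lagrange_acc F (\<phi> (u t)) (velocity (\<lambda>s. \<phi> (u s)) t) (acceleration (\<lambda>s. \<phi> (w s)) r)"
    using ELw by (simp add: euler_lagrange_curve_def wu)
  then show ?thesis
    unfolding euler_lagrange_curve_def acc
    by (intro F.euler_lagrange_acc_shift phi_in u t curve_velocity_nonzero[OF T u t])
qed

end

section \<open>Geodesics of hypersurfaces\<close>

text \<open>For a metric given by an expression \<open>G\<close> that agrees with it only on the domain under consideration,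
  such as a pullback.\<close>

lemma euler_lagrange_at_iff_rep:
  fixes F :: "real^'n::finite \<Rightarrow> real^'n \<Rightarrow> real"
  assumes S: "open S" "smooth_on (S \<times> {y. y \<noteq> 0}) G"
    and F: "\<And>x y. x \<in> S \<Longrightarrow> y \<noteq> 0 \<Longrightarrow> F x y = G (x, y)"
    and T: "open T" "t \<in> T" "C_k 2 T x"
    and x: "\<And>s. s \<in> T \<Longrightarrow> x s \<in> S" "\<And>s. s \<in> T \<Longrightarrow> velocity x s \<noteq> 0"
  shows "euler_lagrange_at F x t \<longleftrightarrow> euler_lagrange_curve G x t"
proof -
  let ?W = "S \<times> {y::real^'n. y \<noteq> 0}"
  have oW: "open ?W" by (rule open_Times_nonzero[OF S(1)])
  have eq: "G z = case_prod F z" if "z \<in> ?W" for z using F that by auto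
  have "smooth_on ?W (case_prod F)" by (rule smooth_on_cong[OF oW eq S(2)])
  from euler_lagrange_at_iff[OF S(1) this T x]
  have "euler_lagrange_at F x t \<longleftrightarrow> euler_lagrange_curve (case_prod F) x t" .
  moreover have "euler_lagrange_curve G x t \<longleftrightarrow> euler_lagrange_curve (case_prod F) x t"
    unfolding euler_lagrange_curve_def by (rule euler_lagrange_acc_cong[OF oW _ eq S(2)]) (use x T in auto)
  ultimately show ?thesis by simp
qed

lemma immersion_subset:
  assumes "immersion U \<phi> S" "open U'" "U' \<subseteq> U" "open S'" "\<And>u. u \<in> U' \<Longrightarrow> \<phi> u \<in> S'"
  shows "immersion U' \<phi> S'"
proof -
  interpret immersion U \<phi> S by fact
  show ?thesis
    by unfold_locales (use assms smooth_on_subset[OF smooth_phi] inj in auto)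
qed

text \<open>The derivative of a chart change is injective since the inverse chart change is differentiable.\<close>

lemma transition_immersion:
  assumes N: "smooth_manifold N" and c: "c \<in> N" and d: "d \<in> N"
  shows "immersion (coord c ` (dom_of c \<inter> dom_of d)) (coord d \<circ> inv_coord c) (cod_of d)"
proof
  have cc: "is_chart c" and dd: "is_chart d" using N c d by (auto simp: smooth_manifold_def)
  let ?U = "coord c ` (dom_of c \<inter> dom_of d)" and ?V = "coord d ` (dom_of c \<inter> dom_of d)"
  let ?f = "coord d \<circ> inv_coord c" and ?g = "coord c \<circ> inv_coord d"
  show oU: "open ?U" by (rule chart_facts(4)[OF cc chart_facts(6)[OF dd]])
  show "open (cod_of d)" by (rule chart_facts(5)[OF dd])
  show f: "smooth_on ?U ?f" using N c d by (auto simp: smooth_manifold_def)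
  have g: "smooth_on ?V ?g" using N c d by (auto simp: smooth_manifold_def Int_commute)
  show "?f u \<in> cod_of d" if "u \<in> ?U" for u using that by (auto simp: chart_facts(1)[OF cc])
  show "D1 ?f u v \<noteq> 0" if u: "u \<in> ?U" and v: "v \<noteq> 0" for u v
  proof
    assume 0: "D1 ?f u v = 0"
    have fu: "?f u \<in> ?V" using u by (auto simp: chart_facts(1)[OF cc])
    have "((\<lambda>x. ?g (?f x)) has_derivative (\<lambda>v. D1 ?g (?f u) (D1 ?f u v))) (at u)"
      using diff_chain_at[OF smooth_on_has_derivative[OF f u] smooth_on_has_derivative[OF g fu]]
      by (simp add: o_def)
    then have "((\<lambda>x. x) has_derivative (\<lambda>v. D1 ?g (?f u) (D1 ?f u v))) (at u)"
      by (rule has_derivative_transform_within_open[OF _ oU u])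
        (auto simp: chart_facts(1)[OF cc] chart_facts(1)[OF dd])
    from fun_cong[OF has_derivative_unique[OF has_derivative_ident this], of v]
    have "v = D1 ?g (?f u) 0" by (simp add: 0)
    also have "\<dots> = 0" by (rule linear_0[OF linear_D1[OF g fu]])
    finally show False using v by simp
  qed
qed

lemma hypersurface_immersion:
  assumes A: "smooth_manifold A" and f: "hypersurface N A f" and c: "c \<in> N" and d: "d \<in> A"
  shows "immersion (coord c ` (dom_of c \<inter> f -` dom_of d)) (coord d \<circ> f \<circ> inv_coord c) (cod_of d)"
proof
  have N: "smooth_manifold N" and sf: "smooth_map N A f" using f by (auto simp: hypersurface_def)
  have cc: "is_chart c" and dd: "is_chart d" using N A c d by (auto simp: smooth_manifold_def)
  let ?U = "coord c ` (dom_of c \<inter> f -` dom_of d)" and ?f = "coord d \<circ> f \<circ> inv_coord c"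
  show "open ?U" by (rule smooth_map_open_preimage[OF N sf c chart_facts(6)[OF dd]])
  show "open (cod_of d)" by (rule chart_facts(5)[OF dd])
  show s: "smooth_on ?U ?f" using sf c d by (auto simp: smooth_map_def)
  show "?f u \<in> cod_of d" if "u \<in> ?U" for u using that by (auto simp: chart_facts(1)[OF cc])
  show "D1 ?f u v \<noteq> 0" if u: "u \<in> ?U" and v: "v \<noteq> 0" for u v
  proof
    assume 0: "D1 ?f u v = 0"
    let ?J = "jacobian ?f (at u)"
    have "(?f has_derivative (\<lambda>h. ?J *v h)) (at u)"
      using smooth_on_differentiable[OF s u] by (simp only: jacobian_works)
    then have "?J *v v = 0" using D1_eqI 0 by metis
    moreover have "inj ((*v) ?J)"
      unfolding full_rank_injective[symmetric] using f c d u by (auto simp: hypersurface_def)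
    ultimately show False using v by (metis injD matrix_vector_mult_0_right)
  qed
qed

lemma local_rep_transition:
  assumes N: "smooth_manifold N" and c: "c \<in> N" and d: "d \<in> N"
    and x: "x \<in> coord c ` (dom_of c \<inter> dom_of d)"
  shows "local_rep N M c x v =
    local_rep N M d ((coord d \<circ> inv_coord c) x) (D1 (coord d \<circ> inv_coord c) x v)"
proof -
  have cc: "is_chart c" and dd: "is_chart d" using N c d by (auto simp: smooth_manifold_def)
  obtain p where p: "p \<in> dom_of c" "p \<in> dom_of d" "x = coord c p" using x by auto
  show ?thesis
    using chart_vec_transform[OF N c p(1) d p(2), of v]
    by (simp add: local_rep_def p(3) chart_facts(1)[OF cc p(1)] chart_facts(1)[OF dd p(2)])
qed

text \<open>A solution in one chart satisfies the equations in all others, because these are the pullbacks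
  of the given ones along chart changes.\<close>

lemma geodesic_of_coordinates:
  fixes N :: "('q::{t2_space,second_countable_topology}, 'm::finite) chart set"
  assumes N: "smooth_manifold N" and c: "c \<in> N"
    and U: "open U" "U \<subseteq> cod_of c" "smooth_on (U \<times> {v. v \<noteq> 0}) (case_prod (local_rep N M c))"
    and I: "I \<noteq> {}" "open I" "is_interval I"
    and w: "C_k 2 I w" "\<And>s. s \<in> I \<Longrightarrow> w s \<in> U" "\<And>s. s \<in> I \<Longrightarrow> velocity w s \<noteq> 0"
    and EL: "\<And>s. s \<in> I \<Longrightarrow> euler_lagrange_curve (case_prod (local_rep N M c)) w s"
  shows "geodesic N M I (inv_coord c \<circ> w)"
proof -
  have cc: "is_chart c" using N c by (auto simp: smooth_manifold_def)
  let ?\<delta> = "inv_coord c \<circ> w"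
  have "continuous_on I w"
    using C_k_2_velocity(1)[OF I(2) w(1)] has_vector_derivative_continuous continuous_at_imp_continuous_on
    by blast
  then have cont: "continuous_on I ?\<delta>"
    by (rule continuous_on_compose[OF _ continuous_on_subset[OF chart_facts(7)[OF cc]]]) (use w(2) U(2) in auto)
  have dom: "?\<delta> s \<in> dom_of c" if "s \<in> I" for s using chart_facts(3)[OF cc] w(2)[OF that] U(2) by auto
  have coord: "coord c (?\<delta> s) = w s" if "s \<in> I" for s using chart_facts(2)[OF cc] w(2)[OF that] U(2) by auto
  have *: "C_k 2 {s \<in> I. ?\<delta> s \<in> dom_of d} (coord d \<circ> ?\<delta>) \<and>
      (\<forall>s\<in>I. ?\<delta> s \<in> dom_of d \<longrightarrow> velocity (coord d \<circ> ?\<delta>) s \<noteq> 0 \<and>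
        euler_lagrange_at (local_rep N M d) (coord d \<circ> ?\<delta>) s)" if d: "d \<in> N" for d
  proof -
    have dd: "is_chart d" using N d by (auto simp: smooth_manifold_def)
    let ?T = "{s \<in> I. ?\<delta> s \<in> dom_of d}"
    have "?T = I \<inter> ?\<delta> -` dom_of d" by auto
    then have oT: "open ?T" using continuous_open_preimage[OF cont I(2) chart_facts(6)[OF dd]] by simp
    have CT: "C_k 2 ?T w" by (rule C_k_mono[OF w(1)]) auto
    interpret cd: immersion "coord c ` (dom_of c \<inter> dom_of d)" "coord d \<circ> inv_coord c" "cod_of d"
      by (rule transition_immersion[OF N c d])
    have wT: "w s \<in> coord c ` (dom_of c \<inter> dom_of d)" if "s \<in> ?T" for s
      using that dom[of s] coord[of s] by (metis (mono_tags, lifting) IntI image_eqI mem_Collect_eq)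
    have C: "C_k 2 ?T (coord d \<circ> ?\<delta>)" using cd.curve_C_k_2[OF oT CT wT] by (simp add: o_def)
    have v: "velocity (coord d \<circ> ?\<delta>) s \<noteq> 0" if "s \<in> ?T" for s
      using cd.curve_velocity_nonzero[OF oT CT wT that] w(3) that by (simp add: o_def)
    \<comment> \<open>The equations are known in \<open>c\<close> and wanted in \<open>d\<close>; the pullback therefore goes along the
      chart change from \<open>d\<close> to \<open>c\<close>, on the part that it maps into \<open>U\<close>.\<close>
    let ?V = "coord d ` (dom_of d \<inter> dom_of c) \<inter> (coord c \<circ> inv_coord d) -` U"
    have dc': "immersion (coord d ` (dom_of d \<inter> dom_of c)) (coord c \<circ> inv_coord d) (cod_of c)"
      by (rule transition_immersion[OF N d c])
    have oV: "open ?V"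
      by (rule continuous_open_preimage[OF smooth_on_continuous_on[OF immersion.smooth_phi[OF dc']]
          immersion.open_U[OF dc'] U(1)])
    interpret dc: immersion ?V "coord c \<circ> inv_coord d" U
      by (rule immersion_subset[OF dc' oV _ U(1)]) auto
    have tau: "(coord c \<circ> inv_coord d) ((coord d \<circ> ?\<delta>) s) = w s" if "s \<in> ?T" for s
      using that coord by (simp add: chart_facts(1)[OF dd])
    have inV: "(coord d \<circ> ?\<delta>) s \<in> ?V" if "s \<in> ?T" for s
      using tau[OF that] w(2) dom that by auto
    have "euler_lagrange_at (local_rep N M d) (coord d \<circ> ?\<delta>) s" if s: "s \<in> ?T" for s
    proof (rule euler_lagrange_at_iff_rep[THEN iffD2])
      show "open ?V" by (rule oV)
      show "smooth_on dc.V (\<lambda>p. case_prod (local_rep N M c) (dc.\<Phi> p))"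
        by (rule smooth_on_compose[OF dc.open_V dc.smooth_Phi U(3) dc.Phi_in])
      show "local_rep N M d x y = case_prod (local_rep N M c) (dc.\<Phi> (x, y))" if "x \<in> ?V" for x y
        using local_rep_transition[OF N d c, of x M y] that by (simp add: tangent_map_def)
      have ELs: "euler_lagrange_curve (case_prod (local_rep N M c)) (\<lambda>s. (coord c \<circ> inv_coord d) ((coord d \<circ> ?\<delta>) s)) s"
        using euler_lagrange_curve_cong[OF oT s tau] EL s by simp
      show "euler_lagrange_curve (\<lambda>p. case_prod (local_rep N M c) (dc.\<Phi> p)) (coord d \<circ> ?\<delta>) s"
        by (rule dc.euler_lagrange_curve_pullback[OF U(3) oT C inV s v[OF s] ELs])
    qed (fact oT s C inV v)+
    with C v show ?thesis by blast
  qed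
  show ?thesis
    unfolding geodesic_def regular_curve_def
    using * I cont dom c by (auto simp: points_def)
qed

text \<open>At each time the given geodesic of the metric induced by \<open>L'\<close> is compared with a geodesic of the
  metric induced by \<open>L\<close> with the same velocity there, which reaches \<open>L'\<close> through the ambient manifold.\<close>

lemma totally_geodesic_transfer:
  fixes A :: "('p::{t2_space, second_countable_topology}, 'n::finite) chart set"
    and N :: "('q::{t2_space, second_countable_topology}, 'm::finite) chart set"
  assumes A: "smooth_manifold A" and L: "finsler A L" and L': "finsler A L'"
    and f: "hypersurface N A f"
    and proj: "\<And>I \<gamma>. geodesic A L I \<gamma> \<Longrightarrow> geodesic A L' I \<gamma>"
    and tot: "totally_geodesic N A f L"
  shows "totally_geodesic N A f L'"
  unfolding totally_geodesic_def
proof (intro allI impI)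
  have N: "smooth_manifold N" and sf: "smooth_map N A f" using f by (auto simp: hypersurface_def)
  fix I \<gamma> assume g: "geodesic N (induced A f L') I \<gamma>"
  then have reg: "regular_curve N I \<gamma>" and EL: "\<And>c t. c \<in> N \<Longrightarrow> t \<in> I \<Longrightarrow> \<gamma> t \<in> dom_of c \<Longrightarrow>
      euler_lagrange_at (local_rep N (induced A f L') c) (coord c \<circ> \<gamma>) t"
    by (auto simp: geodesic_def)
  from reg have I: "I \<noteq> {}" "open I" "is_interval I" and pts: "\<gamma> ` I \<subseteq> points N"
    and cont: "continuous_on I \<gamma>"
    and C2: "\<And>c. c \<in> N \<Longrightarrow> C_k 2 {t \<in> I. \<gamma> t \<in> dom_of c} (coord c \<circ> \<gamma>)"
    and vel: "\<And>c t. c \<in> N \<Longrightarrow> t \<in> I \<Longrightarrow> \<gamma> t \<in> dom_of c \<Longrightarrow> velocity (coord c \<circ> \<gamma>) t \<noteq> 0"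
    by (auto simp: regular_curve_def)
  have contf: "continuous_on (points N) f" and fpts: "f ` points N \<subseteq> points A"
    using sf by (auto simp: smooth_map_def)
  have cf: "continuous_on I (f \<circ> \<gamma>)"
    by (rule continuous_on_compose[OF cont continuous_on_subset[OF contf pts]])
  \<comment> \<open>The claim is local: it suffices to know regularity and the equations near each time and in
    each chart.\<close>
  have step: "\<exists>T. open T \<and> t \<in> T \<and> C_k 2 T (coord d \<circ> (f \<circ> \<gamma>)) \<and>
      velocity (coord d \<circ> (f \<circ> \<gamma>)) t \<noteq> 0 \<and>
      euler_lagrange_at (local_rep A L' d) (coord d \<circ> (f \<circ> \<gamma>)) t"
    if d: "d \<in> A" and t: "t \<in> I" "f (\<gamma> t) \<in> dom_of d" for d t
  proof -
    obtain c where c: "c \<in> N" "\<gamma> t \<in> dom_of c" using pts t(1) by (auto simp: points_def)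
    have cc: "is_chart c" and dd: "is_chart d" using N A c d by (auto simp: smooth_manifold_def)
    let ?U = "coord c ` (dom_of c \<inter> f -` dom_of d)" and ?\<phi> = "coord d \<circ> f \<circ> inv_coord c"
    interpret immersion ?U ?\<phi> "cod_of d" by (rule hypersurface_immersion[OF A f c(1) d])
    define u where "u = coord c \<circ> \<gamma>"
    let ?F = "case_prod (local_rep A L d)" and ?F' = "case_prod (local_rep A L' d)"
    have F: "local_finsler (cod_of d) ?F" and F': "local_finsler (cod_of d) ?F'"
      by (rule finsler_imp_local_finsler[OF _ d dd], fact)+
    have pF: "local_finsler ?U (\<lambda>p. ?F (\<Phi> p))" and pF': "local_finsler ?U (\<lambda>p. ?F' (\<Phi> p))"
      by (rule local_finsler_pullback, fact)+
    have rep: "local_rep N (induced A f H) c x y = case_prod (local_rep A H d) (\<Phi> (x, y))"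
      if "x \<in> ?U" for H x y
      using local_rep_induced[OF N A sf c(1) _ d, of x H y] that
      by (auto simp: tangent_map_def chart_facts(1)[OF cc])
    let ?T = "{s \<in> I. \<gamma> s \<in> dom_of c} \<inter> (f \<circ> \<gamma>) -` dom_of d"
    have "?T = (I \<inter> \<gamma> -` dom_of c) \<inter> (I \<inter> (f \<circ> \<gamma>) -` dom_of d)" by auto
    then have oT: "open ?T"
      using continuous_open_preimage[OF cont I(2) chart_facts(6)[OF cc]]
        continuous_open_preimage[OF cf I(2) chart_facts(6)[OF dd]] by (simp only: open_Int)
    have tT: "t \<in> ?T" using t c by simp
    have CT: "C_k 2 ?T u" unfolding u_def by (rule C_k_mono[OF C2[OF c(1)]]) auto
    have uT: "u s \<in> ?U" if "s \<in> ?T" for s using that by (auto simp: u_def)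
    have vT: "velocity u s \<noteq> 0" if "s \<in> ?T" for s using that vel[OF c(1)] by (auto simp: u_def)
    have xu: "?\<phi> (u s) = (coord d \<circ> (f \<circ> \<gamma>)) s" if "s \<in> ?T" for s
      using that by (auto simp: u_def chart_facts(1)[OF cc])
    have Cx: "C_k 2 ?T (coord d \<circ> (f \<circ> \<gamma>))"
      by (rule C_k_cong[OF oT xu curve_C_k_2[OF oT CT uT]])
    have vx: "velocity (coord d \<circ> (f \<circ> \<gamma>)) s \<noteq> 0" if "s \<in> ?T" for s
    proof -
      have "velocity (\<lambda>s. ?\<phi> (u s)) s \<noteq> 0"
        by (rule curve_velocity_nonzero[OF oT CT uT that vT[OF that]])
      moreover have "velocity (\<lambda>s. ?\<phi> (u s)) s = velocity (coord d \<circ> (f \<circ> \<gamma>)) s"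
        by (rule velocity_cong[OF oT that xu])
      ultimately show ?thesis by simp
    qed
    have ELg: "euler_lagrange_at (local_rep N (induced A f L') c) u t"
      unfolding u_def by (rule EL[OF c(1) t(1) c(2)])
    have ELu: "euler_lagrange_curve (\<lambda>p. ?F' (\<Phi> p)) u t"
      by (rule iffD1[OF euler_lagrange_at_iff_rep[OF open_U local_finsler.smooth_F[OF pF'] rep oT tT CT uT vT] ELg])
    \<comment> \<open>A geodesic of the metric induced by \<open>L\<close> that touches \<open>\<gamma>\<close> at \<open>t\<close> to first order.\<close>
    obtain e w \<eta> \<alpha> where e: "e > 0" and w0: "w 0 = u t" "\<eta> 0 = velocity u t"
      and ca: "continuous_on {-e<..<e} \<alpha>"
      and w: "\<And>s. s \<in> {-e<..<e} \<Longrightarrow> w s \<in> ?U" "\<And>s. s \<in> {-e<..<e} \<Longrightarrow> \<eta> s \<noteq> 0"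
        "\<And>s. s \<in> {-e<..<e} \<Longrightarrow> (w has_vector_derivative \<eta> s) (at s)"
        "\<And>s. s \<in> {-e<..<e} \<Longrightarrow> (\<eta> has_vector_derivative \<alpha> s) (at s)"
        "\<And>s. s \<in> {-e<..<e} \<Longrightarrow> euler_lagrange_acc (\<lambda>p. ?F (\<Phi> p)) (w s) (\<eta> s) (\<alpha> s)"
      using local_finsler.geodesic_exists[OF pF uT[OF tT] vT[OF tT]] by blast
    let ?J = "{-e<..<e}"
    have oJ: "open ?J" and J0: "0 \<in> ?J" using e by auto
    have Cw: "C_k 2 ?J w" by (rule C_k_2I[OF oJ w(3,4) ca])
    have vw: "velocity w s = \<eta> s" if "s \<in> ?J" for s using w(3)[OF that] by (rule vector_derivative_at)
    have aw: "acceleration w s = \<alpha> s" if "s \<in> ?J" for s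
    proof (rule vector_derivative_at)
      show "(velocity w has_vector_derivative \<alpha> s) (at s)"
        by (rule has_vector_derivative_transform_within_open[OF w(4)[OF that] oJ that]) (simp add: vw)
    qed
    have vw0: "velocity w s \<noteq> 0" if "s \<in> ?J" for s using vw[OF that] w(2)[OF that] by simp
    \<comment> \<open>Its image is a geodesic of \<open>L\<close>, hence of \<open>L'\<close>, and so determines the acceleration of
      \<open>f \<circ> \<gamma>\<close> at \<open>t\<close> up to a multiple of the velocity.\<close>
    have "geodesic N (induced A f L) ?J (inv_coord c \<circ> w)"
    proof (rule geodesic_of_coordinates[OF N c(1) open_U])
      have eq: "?F (\<Phi> p) = case_prod (local_rep N (induced A f L) c) p" if "p \<in> V" for p
        using rep that by auto
      show "smooth_on V (case_prod (local_rep N (induced A f L) c))"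
        by (rule smooth_on_cong[OF open_V eq local_finsler.smooth_F[OF pF]])
      show "euler_lagrange_curve (case_prod (local_rep N (induced A f L) c)) w s" if "s \<in> ?J" for s
        using w(5)[OF that] euler_lagrange_acc_cong[OF open_V _ eq local_finsler.smooth_F[OF pF], of "w s" "\<eta> s"] w(1,2)[OF that]
        by (simp add: euler_lagrange_curve_def vw[OF that] aw[OF that])
    qed (use oJ J0 Cw w(1) vw0 in \<open>auto simp: is_interval_oo\<close>)
    then have "geodesic A L' ?J (f \<circ> (inv_coord c \<circ> w))" using proj tot by (auto simp: totally_geodesic_def)
    moreover have "f (inv_coord c (w 0)) \<in> dom_of d" using w(1)[OF J0] by (auto simp: chart_facts(1)[OF cc])
    ultimately have "euler_lagrange_at (local_rep A L' d) (coord d \<circ> (f \<circ> (inv_coord c \<circ> w))) 0"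
      using d J0 by (auto simp: geodesic_def)
    then have "euler_lagrange_at (local_rep A L' d) (\<lambda>s. ?\<phi> (w s)) 0" by (simp add: o_def)
    then have ELw: "euler_lagrange_curve ?F' (\<lambda>s. ?\<phi> (w s)) 0"
      by (subst (asm) euler_lagrange_at_iff[OF open_S local_finsler.smooth_F[OF F'] oJ J0 curve_C_k_2[OF oJ Cw w(1)]
          phi_in[OF w(1)] curve_velocity_nonzero[OF oJ Cw w(1) _ vw0]])
    have wv: "velocity w 0 = velocity u t" by (simp add: vw[OF J0] w0(2))
    have "euler_lagrange_curve ?F' (\<lambda>s. ?\<phi> (u s)) t"
      by (rule euler_lagrange_curve_pushforward[OF F' oT CT uT tT vT[OF tT] ELu oJ Cw w(1) J0 w0(1) wv ELw])
    moreover have "euler_lagrange_curve ?F' (\<lambda>s. ?\<phi> (u s)) t \<longleftrightarrow> euler_lagrange_curve ?F' (coord d \<circ> (f \<circ> \<gamma>)) t"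
      by (rule euler_lagrange_curve_cong[OF oT tT xu])
    ultimately have "euler_lagrange_curve ?F' (coord d \<circ> (f \<circ> \<gamma>)) t" by simp
    moreover have "(coord d \<circ> (f \<circ> \<gamma>)) s \<in> cod_of d" if "s \<in> ?T" for s using that by auto
    ultimately have "euler_lagrange_at (local_rep A L' d) (coord d \<circ> (f \<circ> \<gamma>)) t"
      using euler_lagrange_at_iff[OF open_S local_finsler.smooth_F[OF F'] oT tT Cx _ vx] by blast
    then show ?thesis using oT tT Cx vx[OF tT] by blast
  qed
  show "geodesic A L' I (f \<circ> \<gamma>)"
    unfolding geodesic_def regular_curve_def
  proof (intro conjI ballI impI)
    show "(f \<circ> \<gamma>) ` I \<subseteq> points A" using pts fpts by auto
    fix d assume d: "d \<in> A"
    show "C_k 2 {t \<in> I. (f \<circ> \<gamma>) t \<in> dom_of d} (coord d \<circ> (f \<circ> \<gamma>))"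
      by (rule C_k_local) (use step[OF d] in auto)
    show "velocity (coord d \<circ> (f \<circ> \<gamma>)) t \<noteq> 0" if "t \<in> I" "(f \<circ> \<gamma>) t \<in> dom_of d" for t
      using step[OF d] that by auto
    show "euler_lagrange_at (local_rep A L' d) (coord d \<circ> (f \<circ> \<gamma>)) t"
      if "t \<in> I" "(f \<circ> \<gamma>) t \<in> dom_of d" for t
      using step[OF d] that by auto
  qed (fact I cf)+
qed

theorem theorem4p1:
  fixes A :: "('p::{t2_space, second_countable_topology}, 'n::finite) chart set"
    and N :: "('q::{t2_space, second_countable_topology}, 'm::finite) chart set"
    and L Lstar \<beta> :: "'p tb_fun"
    and \<sigma> :: "'p \<Rightarrow> real"
    and f :: "'q \<Rightarrow> 'p"
  assumes "CARD('n) > 3"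
    and "smooth_manifold A"
    and "finsler A L"
    and "finsler A Lstar"
    and "randers_conformal_change A \<sigma> \<beta> L Lstar"
    and "projectively_related A L Lstar"
    and "hypersurface N A f"
  shows "totally_geodesic N A f L \<longleftrightarrow> totally_geodesic N A f Lstar"
  using totally_geodesic_transfer[OF assms(2,3,4,7)] totally_geodesic_transfer[OF assms(2,4,3,7)] assms(6)
  unfolding projectively_related_def by blast

end
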